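(* Let $\mathbb{F}$ be a field and $\mathsf{G}$ a group. For any two subgroups $H_1$ and $H_2$ of $\mathsf{G}$ and any two 2-cocycles $\sigma_1\in\mathcal{Z}^2(H_1,\mathbb{F}^* )$ and $\sigma_2\in\mathcal{Z}^2(H_2,\mathbb{F}^* )$, there exists a $\mathsf{G}$-imbedding of $\mathbb{F}^{\sigma_1}[H_1]$ into $\mathbb{F}^{\sigma_2}[H_2]$ if and only if $(H_1,\sigma_1)\preceq(H_2,\sigma_2)$, i.e. $H_1\leq H_2$ and $[\sigma_1]=[(\sigma_2)_{H_1}]$ in $\mathcal{H}^2(H_1,\mathbb{F}^* )$.
   Context: Algebras are associative $\mathbb{F}$-algebras. A $\mathsf{G}$-grading on $\mathfrak{A}$ is a vector space decomposition $\mathfrak{A}=\bigoplus_{\xi\in\mathsf{G}}\mathfrak{A}_\xi$ with $\mathfrak{A}_\xi\mathfrak{A}_\zeta\subseteq\mathfrak{A}_{\xi\zeta}$. A $\mathsf{G}$-graded homomorphism $\psi:\mathfrak{B}\to\mathfrak{A}$ is an algebra homomorphism (not required to preserve units) with $\psi(\mathfrak{B}_\xi)\subseteq\mathfrak{A}_\xi$ for all $\xi\in\mathsf{G}$; a $\mathsf{G}$-imbedding is an injective $\mathsf{G}$-graded homomorphism. For a group $H$, $\mathcal{Z}^2(H,\mathbb{F}^* )$ is the group of maps $\sigma:H\times H\to\mathbb{F}^*$ (2-cocycles) with $\sigma(\xi,\zeta)\sigma(\xi\zeta,\varsigma)=\sigma(\xi,\zeta\varsigma)\sigma(\zeta,\varsigma)$;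 $\mathcal{B}^2(H,\mathbb{F}^* )$ is the subgroup of maps $(\xi,\zeta)\mapsto f(\xi)f(\zeta)/f(\xi\zeta)$ with $f:H\to\mathbb{F}^*$ (2-coboundaries); $\mathcal{H}^2=\mathcal{Z}^2/\mathcal{B}^2$, and $[\sigma]$ is the class of $\sigma$. For a subgroup $K\leq H$, $\sigma_K$ is the restriction of $\sigma$ to $K\times K$. The twisted group algebra $\mathbb{F}^{\sigma}[H]$ has $\mathbb{F}$-basis $\{\eta_\xi:\xi\in H\}$ and product $\eta_\xi\eta_\zeta=\sigma(\xi,\zeta)\eta_{\xi\zeta}$. For $H\leq\mathsf{G}$ it is $\mathsf{G}$-graded canonically: the $\xi$-component is $\mathbb{F}\eta_\xi$ for $\xi\in H$ and $0$ for $\xi\notin H$. *)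

theory Defs
  imports "HOL-Algebra.Algebra"
begin

section \<open>Graded algebras\<close>

text \<open>The locale \<^locale>\<open>algebra\<close> of the library demands a commutative multiplication. Here
  algebras are associative only, and since their homomorphisms need not preserve units,
  the unit field of the record is left unconstrained.\<close>

locale assoc_algebra = field F + module F A for F (structure) and A (structure) +
  assumes alg_mult_closed:
      "\<lbrakk>x \<in> carrier A; y \<in> carrier A\<rbrakk> \<Longrightarrow> x \<otimes>\<^bsub>A\<^esub> y \<in> carrier A"
    and alg_mult_assoc:
      "\<lbrakk>x \<in> carrier A; y \<in> carrier A; z \<in> carrier A\<rbrakk> \<Longrightarrow>
       (x \<otimes>\<^bsub>A\<^esub> y) \<otimes>\<^bsub>A\<^esub> z = x \<otimes>\<^bsub>A\<^esub> (y \<otimes>\<^bsub>A\<^esub> z)"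
    and alg_l_distr:
      "\<lbrakk>x \<in> carrier A; y \<in> carrier A; z \<in> carrier A\<rbrakk> \<Longrightarrow>
       (x \<oplus>\<^bsub>A\<^esub> y) \<otimes>\<^bsub>A\<^esub> z = x \<otimes>\<^bsub>A\<^esub> z \<oplus>\<^bsub>A\<^esub> y \<otimes>\<^bsub>A\<^esub> z"
    and alg_r_distr:
      "\<lbrakk>x \<in> carrier A; y \<in> carrier A; z \<in> carrier A\<rbrakk> \<Longrightarrow>
       z \<otimes>\<^bsub>A\<^esub> (x \<oplus>\<^bsub>A\<^esub> y) = z \<otimes>\<^bsub>A\<^esub> x \<oplus>\<^bsub>A\<^esub> z \<otimes>\<^bsub>A\<^esub> y"
    and alg_smult_l:
      "\<lbrakk>c \<in> carrier F; x \<in> carrier A; y \<in> carrier A\<rbrakk> \<Longrightarrow>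
       (c \<odot>\<^bsub>A\<^esub> x) \<otimes>\<^bsub>A\<^esub> y = c \<odot>\<^bsub>A\<^esub> (x \<otimes>\<^bsub>A\<^esub> y)"
    and alg_smult_r:
      "\<lbrakk>c \<in> carrier F; x \<in> carrier A; y \<in> carrier A\<rbrakk> \<Longrightarrow>
       x \<otimes>\<^bsub>A\<^esub> (c \<odot>\<^bsub>A\<^esub> y) = c \<odot>\<^bsub>A\<^esub> (x \<otimes>\<^bsub>A\<^esub> y)"

text \<open>A grading is a family \<open>\<A>\<close> of subspaces indexed by the carrier of the grading group.
  The direct sum condition says that every element has a unique
  decomposition \<open>c\<close>, with \<open>c \<xi> \<in> \<A> \<xi>\<close> and only finitely many \<open>c \<xi>\<close> nonzero.\<close>

locale graded_algebra = assoc_algebra F A + G: group G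
  for F (structure) and G (structure) and A (structure) and \<A> +
  assumes comp_subspace: "\<xi> \<in> carrier G \<Longrightarrow> submodule (\<A> \<xi>) F A"
    and direct_sum:
      "a \<in> carrier A \<Longrightarrow> \<exists>!c. c \<in> (\<Pi>\<^sub>E \<xi>\<in>carrier G. \<A> \<xi>) \<and>
         finite {\<xi> \<in> carrier G. c \<xi> \<noteq> \<zero>\<^bsub>A\<^esub>} \<and>
         a = (\<Oplus>\<^bsub>A\<^esub>\<xi>\<in>{\<xi> \<in> carrier G. c \<xi> \<noteq> \<zero>\<^bsub>A\<^esub>}. c \<xi>)"
    and comp_mult:
      "\<lbrakk>\<xi> \<in> carrier G; \<zeta> \<in> carrier G; x \<in> \<A> \<xi>; y \<in> \<A> \<zeta>\<rbrakk> \<Longrightarrow>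
       x \<otimes>\<^bsub>A\<^esub> y \<in> \<A> (\<xi> \<otimes>\<^bsub>G\<^esub> \<zeta>)"

locale graded_hom =
  B: graded_algebra F G B \<B> + A: graded_algebra F G A \<A>
  for F (structure) and G (structure) and B (structure) and \<B> and A (structure) and \<A> +
  fixes \<psi>
  assumes hom_closed: "\<psi> \<in> carrier B \<rightarrow> carrier A"
    and hom_add: "\<lbrakk>x \<in> carrier B; y \<in> carrier B\<rbrakk> \<Longrightarrow> \<psi> (x \<oplus>\<^bsub>B\<^esub> y) = \<psi> x \<oplus>\<^bsub>A\<^esub> \<psi> y"
    and hom_smult: "\<lbrakk>c \<in> carrier F; x \<in> carrier B\<rbrakk> \<Longrightarrow> \<psi> (c \<odot>\<^bsub>B\<^esub> x) = c \<odot>\<^bsub>A\<^esub> \<psi> x"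
    and hom_mult: "\<lbrakk>x \<in> carrier B; y \<in> carrier B\<rbrakk> \<Longrightarrow> \<psi> (x \<otimes>\<^bsub>B\<^esub> y) = \<psi> x \<otimes>\<^bsub>A\<^esub> \<psi> y"
    and hom_graded: "\<xi> \<in> carrier G \<Longrightarrow> \<psi> ` \<B> \<xi> \<subseteq> \<A> \<xi>"

locale graded_imbedding = graded_hom F G B \<B> A \<A> \<psi>
  for F (structure) and G (structure) and B (structure) and \<B> and A (structure) and \<A> and \<psi> +
  assumes inj: "inj_on \<psi> (carrier B)"


section \<open>Second cohomology group\<close>

text \<open>Cochains \<open>H \<times> H \<rightarrow> M\<close> with values in an abelian group \<open>M\<close> (trivial action) are
  extensional functions on \<open>carrier H \<times> carrier H\<close>. The coefficient group
  \<open>\<bbbF>\<^sup>*\<close> is \<^term>\<open>units_of F\<close>.\<close>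

definition cocycles2 :: "('h, 'n) monoid_scheme \<Rightarrow> ('f, 'm) monoid_scheme \<Rightarrow> ('h \<times> 'h \<Rightarrow> 'f) monoid"
  where "cocycles2 H M = \<lparr>
    carrier = {\<sigma> \<in> carrier H \<times> carrier H \<rightarrow>\<^sub>E carrier M.
      \<forall>\<xi>\<in>carrier H. \<forall>\<zeta>\<in>carrier H. \<forall>\<kappa>\<in>carrier H.
        \<sigma> (\<xi>, \<zeta>) \<otimes>\<^bsub>M\<^esub> \<sigma> (\<xi> \<otimes>\<^bsub>H\<^esub> \<zeta>, \<kappa>) = \<sigma> (\<xi>, \<zeta> \<otimes>\<^bsub>H\<^esub> \<kappa>) \<otimes>\<^bsub>M\<^esub> \<sigma> (\<zeta>, \<kappa>)},
    monoid.mult = (\<lambda>\<sigma> \<tau>. \<lambda>p\<in>carrier H \<times> carrier H. \<sigma> p \<otimes>\<^bsub>M\<^esub> \<tau> p),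
    one = (\<lambda>p\<in>carrier H \<times> carrier H. \<one>\<^bsub>M\<^esub>)\<rparr>"

definition coboundaries2 :: "('h, 'n) monoid_scheme \<Rightarrow> ('f, 'm) monoid_scheme \<Rightarrow> ('h \<times> 'h \<Rightarrow> 'f) set"
  where "coboundaries2 H M =
    {(\<lambda>(\<xi>, \<zeta>)\<in>carrier H \<times> carrier H. f \<xi> \<otimes>\<^bsub>M\<^esub> f \<zeta> \<otimes>\<^bsub>M\<^esub> inv\<^bsub>M\<^esub> f (\<xi> \<otimes>\<^bsub>H\<^esub> \<zeta>)) | f.
       f \<in> carrier H \<rightarrow> carrier M}"

definition cohomology2 :: "('h, 'n) monoid_scheme \<Rightarrow> ('f, 'm) monoid_scheme \<Rightarrow> ('h \<times> 'h \<Rightarrow> 'f) set monoid"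
  where "cohomology2 H M = cocycles2 H M Mod coboundaries2 H M"

definition cohomology_class ::
    "('h, 'n) monoid_scheme \<Rightarrow> ('f, 'm) monoid_scheme \<Rightarrow> ('h \<times> 'h \<Rightarrow> 'f) \<Rightarrow> ('h \<times> 'h \<Rightarrow> 'f) set"
  where "cohomology_class H M \<sigma> = coboundaries2 H M #>\<^bsub>cocycles2 H M\<^esub> \<sigma>"

definition cocycle_restrict :: "('g \<times> 'g \<Rightarrow> 'f) \<Rightarrow> 'g set \<Rightarrow> 'g \<times> 'g \<Rightarrow> 'f"
  where "cocycle_restrict \<sigma> K = restrict \<sigma> (K \<times> K)"

text \<open>The relation \<open>(H\<^sub>1, \<sigma>\<^sub>1) \<preceq> (H\<^sub>2, \<sigma>\<^sub>2)\<close> for subgroups of \<open>G\<close> with \<open>\<bbbF>\<^sup>*\<close>-valued cocycles.\<close>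

definition cocycle_pair_le ::
    "('f, 'm) ring_scheme \<Rightarrow> ('g, 'n) monoid_scheme \<Rightarrow>
     'g set \<times> ('g \<times> 'g \<Rightarrow> 'f) \<Rightarrow> 'g set \<times> ('g \<times> 'g \<Rightarrow> 'f) \<Rightarrow> bool"
  where "cocycle_pair_le F G = (\<lambda>(H\<^sub>1, \<sigma>\<^sub>1) (H\<^sub>2, \<sigma>\<^sub>2).
    subgroup H\<^sub>1 (G\<lparr>carrier := H\<^sub>2\<rparr>) \<and>
    cohomology_class (G\<lparr>carrier := H\<^sub>1\<rparr>) (units_of F) \<sigma>\<^sub>1 =
    cohomology_class (G\<lparr>carrier := H\<^sub>1\<rparr>) (units_of F) (cocycle_restrict \<sigma>\<^sub>2 H\<^sub>1))"


section \<open>Twisted group algebras\<close>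

definition supp_on :: "('f, 'm) ring_scheme \<Rightarrow> ('h, 'n) monoid_scheme \<Rightarrow> ('h \<Rightarrow> 'f) \<Rightarrow> 'h set"
  where "supp_on F H a = {\<xi> \<in> carrier H. a \<xi> \<noteq> \<zero>\<^bsub>F\<^esub>}"

text \<open>An element \<open>\<Sum>\<^sub>\<xi> a\<^sub>\<xi> \<eta>\<^sub>\<xi>\<close> is represented by its coefficient function \<open>a\<close>, which is extensional
  on \<open>H\<close> and finitely supported; the product is the bilinear extension of
  \<open>\<eta>\<^sub>\<xi> \<eta>\<^sub>\<zeta> = \<sigma>(\<xi>,\<zeta>) \<eta>\<^sub>\<xi>\<^sub>\<zeta>\<close>. As \<open>\<sigma>\<close> is not assumed normalized, the unit
  is \<open>\<sigma>(1,1)\<^sup>-\<^sup>1 \<eta>\<^sub>1\<close>.\<close>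

definition twisted_group_algebra ::
    "('f, 'm) ring_scheme \<Rightarrow> ('h, 'n) monoid_scheme \<Rightarrow> ('h \<times> 'h \<Rightarrow> 'f) \<Rightarrow> ('f, 'h \<Rightarrow> 'f) module"
  where "twisted_group_algebra F H \<sigma> = \<lparr>
    carrier = {a \<in> carrier H \<rightarrow>\<^sub>E carrier F. finite (supp_on F H a)},
    monoid.mult = (\<lambda>a b. \<lambda>\<kappa>\<in>carrier H.
      finsum F (\<lambda>(\<xi>, \<zeta>). a \<xi> \<otimes>\<^bsub>F\<^esub> b \<zeta> \<otimes>\<^bsub>F\<^esub> \<sigma> (\<xi>, \<zeta>))
        {(\<xi>, \<zeta>) \<in> supp_on F H a \<times> supp_on F H b. \<xi> \<otimes>\<^bsub>H\<^esub> \<zeta> = \<kappa>}),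
    one = (\<lambda>\<xi>\<in>carrier H. if \<xi> = \<one>\<^bsub>H\<^esub> then inv\<^bsub>F\<^esub> \<sigma> (\<one>\<^bsub>H\<^esub>, \<one>\<^bsub>H\<^esub>) else \<zero>\<^bsub>F\<^esub>),
    ring.zero = (\<lambda>\<xi>\<in>carrier H. \<zero>\<^bsub>F\<^esub>),
    ring.add = (\<lambda>a b. \<lambda>\<xi>\<in>carrier H. a \<xi> \<oplus>\<^bsub>F\<^esub> b \<xi>),
    module.smult = (\<lambda>c a. \<lambda>\<xi>\<in>carrier H. c \<otimes>\<^bsub>F\<^esub> a \<xi>)\<rparr>"

definition eta :: "('f, 'm) ring_scheme \<Rightarrow> ('h, 'n) monoid_scheme \<Rightarrow> 'h \<Rightarrow> 'h \<Rightarrow> 'f"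
  where "eta F H \<xi> = (\<lambda>\<kappa>\<in>carrier H. if \<kappa> = \<xi> then \<one>\<^bsub>F\<^esub> else \<zero>\<^bsub>F\<^esub>)"

text \<open>The index \<open>\<xi>\<close> below ranges over a group containing \<open>H\<close> as a subgroup.\<close>

definition canonical_grading ::
    "('f, 'm) ring_scheme \<Rightarrow> ('h, 'n) monoid_scheme \<Rightarrow> ('h \<times> 'h \<Rightarrow> 'f) \<Rightarrow> 'h \<Rightarrow> ('h \<Rightarrow> 'f) set"
  where "canonical_grading F H \<sigma> \<xi> =
    (if \<xi> \<in> carrier H then {c \<odot>\<^bsub>twisted_group_algebra F H \<sigma>\<^esub> eta F H \<xi> | c. c \<in> carrier F}
     else {\<zero>\<^bsub>twisted_group_algebra F H \<sigma>\<^esub>})"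


subsection \<open>Well-definedness\<close>

lemma tga_carrier: "a \<in> carrier (twisted_group_algebra F H \<sigma>) \<longleftrightarrow>
    a \<in> carrier H \<rightarrow>\<^sub>E carrier F \<and> finite (supp_on F H a)"
  and tga_mult: "\<kappa> \<in> carrier H \<Longrightarrow> (a \<otimes>\<^bsub>twisted_group_algebra F H \<sigma>\<^esub> b) \<kappa> =
    finsum F (\<lambda>(\<xi>, \<zeta>). a \<xi> \<otimes>\<^bsub>F\<^esub> b \<zeta> \<otimes>\<^bsub>F\<^esub> \<sigma> (\<xi>, \<zeta>))
      {(\<xi>, \<zeta>) \<in> supp_on F H a \<times> supp_on F H b. \<xi> \<otimes>\<^bsub>H\<^esub> \<zeta> = \<kappa>}"
  and tga_one: "\<one>\<^bsub>twisted_group_algebra F H \<sigma>\<^esub> =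
    (\<lambda>\<xi>\<in>carrier H. if \<xi> = \<one>\<^bsub>H\<^esub> then inv\<^bsub>F\<^esub> \<sigma> (\<one>\<^bsub>H\<^esub>, \<one>\<^bsub>H\<^esub>) else \<zero>\<^bsub>F\<^esub>)"
  and tga_zero: "\<xi> \<in> carrier H \<Longrightarrow> \<zero>\<^bsub>twisted_group_algebra F H \<sigma>\<^esub> \<xi> = \<zero>\<^bsub>F\<^esub>"
  and tga_add: "\<xi> \<in> carrier H \<Longrightarrow> (a \<oplus>\<^bsub>twisted_group_algebra F H \<sigma>\<^esub> b) \<xi> = a \<xi> \<oplus>\<^bsub>F\<^esub> b \<xi>"
  and tga_smult: "\<xi> \<in> carrier H \<Longrightarrow> (c \<odot>\<^bsub>twisted_group_algebra F H \<sigma>\<^esub> a) \<xi> = c \<otimes>\<^bsub>F\<^esub> a \<xi>"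
  and tga_extensional:
    "a \<otimes>\<^bsub>twisted_group_algebra F H \<sigma>\<^esub> b \<in> extensional (carrier H)"
    "\<zero>\<^bsub>twisted_group_algebra F H \<sigma>\<^esub> \<in> extensional (carrier H)"
    "a \<oplus>\<^bsub>twisted_group_algebra F H \<sigma>\<^esub> b \<in> extensional (carrier H)"
    "c \<odot>\<^bsub>twisted_group_algebra F H \<sigma>\<^esub> a \<in> extensional (carrier H)"
  unfolding twisted_group_algebra_def by simp_all

locale twisted_group_algebra_data = H: group H + F: field F for F (structure) and H (structure) +
  fixes \<sigma>
  assumes cocycle: "\<sigma> \<in> carrier (cocycles2 H (units_of F))"
begin

abbreviation T where "T \<equiv> twisted_group_algebra F H \<sigma>"
abbreviation e where "e \<equiv> eta F H"

lemma sigma_closed [simp]: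
  assumes "x \<in> carrier H" "y \<in> carrier H"
  shows "\<sigma> (x, y) \<in> carrier F" "\<sigma> (x, y) \<noteq> \<zero>\<^bsub>F\<^esub>"
  using cocycle assms by (auto simp: cocycles2_def PiE_def Pi_def units_of_def F.field_Units)

lemma sigma_cocycle:
  "\<lbrakk>x \<in> carrier H; y \<in> carrier H; z \<in> carrier H\<rbrakk> \<Longrightarrow>
   \<sigma> (x, y) \<otimes>\<^bsub>F\<^esub> \<sigma> (x \<otimes>\<^bsub>H\<^esub> y, z) = \<sigma> (x, y \<otimes>\<^bsub>H\<^esub> z) \<otimes>\<^bsub>F\<^esub> \<sigma> (y, z)"
  using cocycle by (auto simp: cocycles2_def units_of_def)

lemma T_ext: "\<lbrakk>a \<in> carrier T; b \<in> carrier T; \<And>x. x \<in> carrier H \<Longrightarrow> a x = b x\<rbrakk> \<Longrightarrow> a = b"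
  unfolding tga_carrier by (blast intro: PiE_ext)

lemma T_closed: "\<lbrakk>a \<in> carrier T; x \<in> carrier H\<rbrakk> \<Longrightarrow> a x \<in> carrier F"
  unfolding tga_carrier by (blast dest: PiE_mem)

lemma T_finite [simp]: "a \<in> carrier T \<Longrightarrow> finite (supp_on F H a)"
  unfolding tga_carrier by blast

lemma supp_subset: "supp_on F H a \<subseteq> carrier H"
  by (auto simp: supp_on_def)

lemma T_I:
  assumes "a \<in> extensional (carrier H)" "\<And>x. x \<in> carrier H \<Longrightarrow> a x \<in> carrier F"
    and S: "finite S" "\<And>x. \<lbrakk>x \<in> carrier H; x \<notin> S\<rbrakk> \<Longrightarrow> a x = \<zero>\<^bsub>F\<^esub>"
  shows "a \<in> carrier T"
proof -
  have "supp_on F H a \<subseteq> S" unfolding supp_on_def using S(2) by blast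
  then have "finite (supp_on F H a)" using S(1) by (rule finite_subset)
  then show ?thesis unfolding tga_carrier PiE_def Pi_def using assms(1,2) by blast
qed

lemma zero_apply [simp]: "x \<in> carrier H \<Longrightarrow> \<zero>\<^bsub>T\<^esub> x = \<zero>\<^bsub>F\<^esub>"
  and add_apply [simp]: "x \<in> carrier H \<Longrightarrow> (a \<oplus>\<^bsub>T\<^esub> b) x = a x \<oplus>\<^bsub>F\<^esub> b x"
  and smult_apply [simp]: "x \<in> carrier H \<Longrightarrow> (c \<odot>\<^bsub>T\<^esub> a) x = c \<otimes>\<^bsub>F\<^esub> a x"
  by (simp_all add: tga_zero tga_add tga_smult)

lemma eta_apply [simp]: "x \<in> carrier H \<Longrightarrow> e y x = (if x = y then \<one>\<^bsub>F\<^esub> else \<zero>\<^bsub>F\<^esub>)"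
  by (auto simp: eta_def)

lemma zero_closed [simp]: "\<zero>\<^bsub>T\<^esub> \<in> carrier T"
  by (rule T_I[of _ "{}"]) (simp_all add: tga_extensional)

lemma eta_closed [simp]: "e x \<in> carrier T"
  by (rule T_I[of _ "{x}"]) (auto simp: eta_def)

lemma add_closed [simp]:
  assumes a: "a \<in> carrier T" and b: "b \<in> carrier T"
  shows "a \<oplus>\<^bsub>T\<^esub> b \<in> carrier T"
proof (rule T_I[of _ "supp_on F H a \<union> supp_on F H b"])
  note [simp] = T_closed[OF a] T_closed[OF b]
  show "a \<oplus>\<^bsub>T\<^esub> b \<in> extensional (carrier H)" by (rule tga_extensional)
  show "finite (supp_on F H a \<union> supp_on F H b)" using a b by simp
  fix x assume x: "x \<in> carrier H"
  then show "(a \<oplus>\<^bsub>T\<^esub> b) x \<in> carrier F" by simp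
  assume "x \<notin> supp_on F H a \<union> supp_on F H b"
  then show "(a \<oplus>\<^bsub>T\<^esub> b) x = \<zero>\<^bsub>F\<^esub>" using x by (simp add: supp_on_def)
qed

lemma smult_closed [simp]:
  assumes c: "c \<in> carrier F" and a: "a \<in> carrier T"
  shows "c \<odot>\<^bsub>T\<^esub> a \<in> carrier T"
proof (rule T_I[of _ "supp_on F H a"])
  note [simp] = T_closed[OF a]
  show "c \<odot>\<^bsub>T\<^esub> a \<in> extensional (carrier H)" by (rule tga_extensional)
  show "finite (supp_on F H a)" using a by simp
  fix x assume x: "x \<in> carrier H"
  then show "(c \<odot>\<^bsub>T\<^esub> a) x \<in> carrier F" using c by simp
  assume "x \<notin> supp_on F H a"
  then show "(c \<odot>\<^bsub>T\<^esub> a) x = \<zero>\<^bsub>F\<^esub>" using c x by (simp add: supp_on_def)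
qed

lemma mult_apply:
  assumes "a \<in> carrier T" "b \<in> carrier T" "x \<in> carrier H"
    "finite S" "S \<subseteq> carrier H" "supp_on F H a \<subseteq> S"
    "finite R" "R \<subseteq> carrier H" "supp_on F H b \<subseteq> R"
  shows "(a \<otimes>\<^bsub>T\<^esub> b) x =
    finsum F (\<lambda>(y, z). a y \<otimes>\<^bsub>F\<^esub> b z \<otimes>\<^bsub>F\<^esub> \<sigma> (y, z)) {(y, z) \<in> S \<times> R. y \<otimes>\<^bsub>H\<^esub> z = x}"
proof -
  note [simp] = T_closed[OF assms(1)] T_closed[OF assms(2)]
  have "(a \<otimes>\<^bsub>T\<^esub> b) x =
    finsum F (\<lambda>(y, z). a y \<otimes>\<^bsub>F\<^esub> b z \<otimes>\<^bsub>F\<^esub> \<sigma> (y, z))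
      {(y, z) \<in> supp_on F H a \<times> supp_on F H b. y \<otimes>\<^bsub>H\<^esub> z = x}"
    using assms(3) by (rule tga_mult)
  also have "\<dots> =
    finsum F (\<lambda>(y, z). a y \<otimes>\<^bsub>F\<^esub> b z \<otimes>\<^bsub>F\<^esub> \<sigma> (y, z)) {(y, z) \<in> S \<times> R. y \<otimes>\<^bsub>H\<^esub> z = x}"
  proof (rule F.add.finprod_mono_neutral_cong_left)
    show "finite {(y, z) \<in> S \<times> R. y \<otimes>\<^bsub>H\<^esub> z = x}"
      by (rule finite_subset[of _ "S \<times> R"]) (use assms in auto)
    fix p assume "p \<in> {(y, z) \<in> S \<times> R. y \<otimes>\<^bsub>H\<^esub> z = x} -
      {(y, z) \<in> supp_on F H a \<times> supp_on F H b. y \<otimes>\<^bsub>H\<^esub> z = x}"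
    then obtain y z where p: "p = (y, z)" "y \<in> carrier H" "z \<in> carrier H"
        "a y = \<zero>\<^bsub>F\<^esub> \<or> b z = \<zero>\<^bsub>F\<^esub>"
      using assms(5,8) by (auto simp: supp_on_def)
    then show "(case p of (y, z) \<Rightarrow> a y \<otimes>\<^bsub>F\<^esub> b z \<otimes>\<^bsub>F\<^esub> \<sigma> (y, z)) = \<zero>\<^bsub>F\<^esub>"
      using assms(1,2) by auto
  next
    show "(\<lambda>(y, z). a y \<otimes>\<^bsub>F\<^esub> b z \<otimes>\<^bsub>F\<^esub> \<sigma> (y, z)) \<in> {(y, z) \<in> S \<times> R. y \<otimes>\<^bsub>H\<^esub> z = x} \<rightarrow> carrier F"
      using assms(1,2,5,8) by (auto simp: subset_iff)
  qed (use assms in auto)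
  finally show ?thesis .
qed

lemma mult_closed [simp]:
  assumes "a \<in> carrier T" "b \<in> carrier T"
  shows "a \<otimes>\<^bsub>T\<^esub> b \<in> carrier T"
proof (rule T_I[of _ "(\<lambda>(y, z). y \<otimes>\<^bsub>H\<^esub> z) ` (supp_on F H a \<times> supp_on F H b)"])
  note [simp] = T_closed[OF assms(1)] T_closed[OF assms(2)]
  show "a \<otimes>\<^bsub>T\<^esub> b \<in> extensional (carrier H)" by (rule tga_extensional)
  show "finite ((\<lambda>(y, z). y \<otimes>\<^bsub>H\<^esub> z) ` (supp_on F H a \<times> supp_on F H b))"
    using assms by auto
  fix x assume x: "x \<in> carrier H"
  note eq = mult_apply[OF assms x T_finite[OF assms(1)] supp_subset order_refl
    T_finite[OF assms(2)] supp_subset order_refl]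
  show "(a \<otimes>\<^bsub>T\<^esub> b) x \<in> carrier F"
    unfolding eq using assms by (intro F.finsum_closed) (auto simp: supp_on_def)
  assume "x \<notin> (\<lambda>(y, z). y \<otimes>\<^bsub>H\<^esub> z) ` (supp_on F H a \<times> supp_on F H b)"
  then have "{(y, z) \<in> supp_on F H a \<times> supp_on F H b. y \<otimes>\<^bsub>H\<^esub> z = x} = {}" by force
  then show "(a \<otimes>\<^bsub>T\<^esub> b) x = \<zero>\<^bsub>F\<^esub>" unfolding eq by (simp only: F.finsum_empty)
qed

lemma T_module: "module F T"
proof (rule moduleI)
  show "cring F" by (rule F.is_cring)
  show "abelian_group T"
  proof (rule abelian_groupI)
    fix a assume a: "a \<in> carrier T"
    show "\<exists>b\<in>carrier T. b \<oplus>\<^bsub>T\<^esub> a = \<zero>\<^bsub>T\<^esub>"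
      by (rule bexI[of _ "(\<ominus>\<^bsub>F\<^esub> \<one>\<^bsub>F\<^esub>) \<odot>\<^bsub>T\<^esub> a"], rule T_ext)
        (use a T_closed[OF a] in \<open>auto simp: F.l_minus F.l_neg\<close>)
  qed (simp | rule T_ext | simp add: T_closed F.a_ac)+
qed (simp | rule T_ext | simp add: T_closed F.l_distr F.r_distr F.m_assoc)+

lemma mult_smult:
  assumes c: "c \<in> carrier F" and a: "a \<in> carrier T" and b: "b \<in> carrier T"
  shows "(c \<odot>\<^bsub>T\<^esub> a) \<otimes>\<^bsub>T\<^esub> b = c \<odot>\<^bsub>T\<^esub> (a \<otimes>\<^bsub>T\<^esub> b)"
    and "a \<otimes>\<^bsub>T\<^esub> (c \<odot>\<^bsub>T\<^esub> b) = c \<odot>\<^bsub>T\<^esub> (a \<otimes>\<^bsub>T\<^esub> b)"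
proof -
  note [simp] = T_closed[OF a] T_closed[OF b]
  let ?S = "supp_on F H a" and ?R = "supp_on F H b"
  have S: "supp_on F H (c \<odot>\<^bsub>T\<^esub> a) \<subseteq> ?S" and R: "supp_on F H (c \<odot>\<^bsub>T\<^esub> b) \<subseteq> ?R"
    using c by (auto simp: supp_on_def)
  have *: "((c \<odot>\<^bsub>T\<^esub> a) \<otimes>\<^bsub>T\<^esub> b) x = c \<otimes>\<^bsub>F\<^esub> (a \<otimes>\<^bsub>T\<^esub> b) x \<and>
      (a \<otimes>\<^bsub>T\<^esub> (c \<odot>\<^bsub>T\<^esub> b)) x = c \<otimes>\<^bsub>F\<^esub> (a \<otimes>\<^bsub>T\<^esub> b) x" if x: "x \<in> carrier H" for x
  proof -
    let ?D = "{(y, z) \<in> ?S \<times> ?R. y \<otimes>\<^bsub>H\<^esub> z = x}"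
    have fin: "finite ?D" by (rule finite_subset[of _ "?S \<times> ?R"]) (use a b in auto)
    have cl: "(\<lambda>(y, z). a y \<otimes>\<^bsub>F\<^esub> b z \<otimes>\<^bsub>F\<^esub> \<sigma> (y, z)) \<in> ?D \<rightarrow> carrier F"
      using a b by (auto simp: supp_on_def)
    have 0: "(a \<otimes>\<^bsub>T\<^esub> b) x = finsum F (\<lambda>(y, z). a y \<otimes>\<^bsub>F\<^esub> b z \<otimes>\<^bsub>F\<^esub> \<sigma> (y, z)) ?D"
      by (rule mult_apply) (use a b x supp_subset in auto)
    have 1: "((c \<odot>\<^bsub>T\<^esub> a) \<otimes>\<^bsub>T\<^esub> b) x =
        finsum F (\<lambda>(y, z). (c \<odot>\<^bsub>T\<^esub> a) y \<otimes>\<^bsub>F\<^esub> b z \<otimes>\<^bsub>F\<^esub> \<sigma> (y, z)) ?D"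
      by (rule mult_apply) (use a b c x S supp_subset in auto)
    have 2: "(a \<otimes>\<^bsub>T\<^esub> (c \<odot>\<^bsub>T\<^esub> b)) x =
        finsum F (\<lambda>(y, z). a y \<otimes>\<^bsub>F\<^esub> (c \<odot>\<^bsub>T\<^esub> b) z \<otimes>\<^bsub>F\<^esub> \<sigma> (y, z)) ?D"
      by (rule mult_apply) (use a b c x R supp_subset in auto)
    have d: "c \<otimes>\<^bsub>F\<^esub> (a \<otimes>\<^bsub>T\<^esub> b) x =
        finsum F (\<lambda>p. c \<otimes>\<^bsub>F\<^esub> (case p of (y, z) \<Rightarrow> a y \<otimes>\<^bsub>F\<^esub> b z \<otimes>\<^bsub>F\<^esub> \<sigma> (y, z))) ?D"
      unfolding 0 using fin c cl by (intro F.finsum_rdistr)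
    show ?thesis unfolding 1 2 d
      by (intro conjI F.finsum_cong')
        (use a b c cl in \<open>auto simp: supp_on_def F.m_ac\<close>)
  qed
  show "(c \<odot>\<^bsub>T\<^esub> a) \<otimes>\<^bsub>T\<^esub> b = c \<odot>\<^bsub>T\<^esub> (a \<otimes>\<^bsub>T\<^esub> b)" "a \<otimes>\<^bsub>T\<^esub> (c \<odot>\<^bsub>T\<^esub> b) = c \<odot>\<^bsub>T\<^esub> (a \<otimes>\<^bsub>T\<^esub> b)"
    by (rule T_ext; use * a b c in simp)+
qed

lemma mult_add:
  assumes a: "a \<in> carrier T" and b: "b \<in> carrier T" and d: "d \<in> carrier T"
  shows "(a \<oplus>\<^bsub>T\<^esub> b) \<otimes>\<^bsub>T\<^esub> d = a \<otimes>\<^bsub>T\<^esub> d \<oplus>\<^bsub>T\<^esub> b \<otimes>\<^bsub>T\<^esub> d"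
    and "d \<otimes>\<^bsub>T\<^esub> (a \<oplus>\<^bsub>T\<^esub> b) = d \<otimes>\<^bsub>T\<^esub> a \<oplus>\<^bsub>T\<^esub> d \<otimes>\<^bsub>T\<^esub> b"
proof -
  note [simp] = T_closed[OF a] T_closed[OF b] T_closed[OF d]
  let ?S = "supp_on F H a \<union> supp_on F H b" and ?R = "supp_on F H d"
  have S: "supp_on F H (a \<oplus>\<^bsub>T\<^esub> b) \<subseteq> ?S" by (auto simp: supp_on_def)
  have *: "((a \<oplus>\<^bsub>T\<^esub> b) \<otimes>\<^bsub>T\<^esub> d) x = (a \<otimes>\<^bsub>T\<^esub> d) x \<oplus>\<^bsub>F\<^esub> (b \<otimes>\<^bsub>T\<^esub> d) x" if x: "x \<in> carrier H" for x
  proof -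
    let ?D = "{(y, z) \<in> ?S \<times> ?R. y \<otimes>\<^bsub>H\<^esub> z = x}"
    have D: "(u \<otimes>\<^bsub>T\<^esub> d) x = finsum F (\<lambda>(y, z). u y \<otimes>\<^bsub>F\<^esub> d z \<otimes>\<^bsub>F\<^esub> \<sigma> (y, z)) ?D"
      if "u \<in> carrier T" "supp_on F H u \<subseteq> ?S" for u
      by (rule mult_apply) (use that a b d x supp_subset in auto)
    show ?thesis
      apply (subst (1 2 3) D)
            apply (use a b S in \<open>auto\<close>)[6]
      apply (subst F.finsum_addf[symmetric])
        apply (use a b d in \<open>auto simp: supp_on_def\<close>)[2]
      apply (rule F.finsum_cong')
        apply (use a b d in \<open>auto simp: supp_on_def F.l_distr\<close>)
      done
  qed
  show "(a \<oplus>\<^bsub>T\<^esub> b) \<otimes>\<^bsub>T\<^esub> d = a \<otimes>\<^bsub>T\<^esub> d \<oplus>\<^bsub>T\<^esub> b \<otimes>\<^bsub>T\<^esub> d"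
    by (rule T_ext; use * a b d in simp)
  have *: "(d \<otimes>\<^bsub>T\<^esub> (a \<oplus>\<^bsub>T\<^esub> b)) x = (d \<otimes>\<^bsub>T\<^esub> a) x \<oplus>\<^bsub>F\<^esub> (d \<otimes>\<^bsub>T\<^esub> b) x" if x: "x \<in> carrier H" for x
  proof -
    let ?D = "{(y, z) \<in> ?R \<times> ?S. y \<otimes>\<^bsub>H\<^esub> z = x}"
    have D: "(d \<otimes>\<^bsub>T\<^esub> u) x = finsum F (\<lambda>(y, z). d y \<otimes>\<^bsub>F\<^esub> u z \<otimes>\<^bsub>F\<^esub> \<sigma> (y, z)) ?D"
      if "u \<in> carrier T" "supp_on F H u \<subseteq> ?S" for u
      by (rule mult_apply) (use that a b d x supp_subset in auto)
    show ?thesis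
      apply (subst (1 2 3) D)
            apply (use a b S in \<open>auto\<close>)[6]
      apply (subst F.finsum_addf[symmetric])
        apply (use a b d in \<open>auto simp: supp_on_def\<close>)[2]
      apply (rule F.finsum_cong')
        apply (use a b d in \<open>auto simp: supp_on_def F.l_distr F.r_distr\<close>)
      done
  qed
  show "d \<otimes>\<^bsub>T\<^esub> (a \<oplus>\<^bsub>T\<^esub> b) = d \<otimes>\<^bsub>T\<^esub> a \<oplus>\<^bsub>T\<^esub> d \<otimes>\<^bsub>T\<^esub> b"
    by (rule T_ext; use * a b d in simp)
qed

lemma eta_mult:
  assumes "x \<in> carrier H" "y \<in> carrier H"
  shows "e x \<otimes>\<^bsub>T\<^esub> e y = \<sigma> (x, y) \<odot>\<^bsub>T\<^esub> e (x \<otimes>\<^bsub>H\<^esub> y)"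
proof (rule T_ext)
  fix z assume z: "z \<in> carrier H"
  have "(e x \<otimes>\<^bsub>T\<^esub> e y) z =
    finsum F (\<lambda>(u, v). e x u \<otimes>\<^bsub>F\<^esub> e y v \<otimes>\<^bsub>F\<^esub> \<sigma> (u, v)) {(u, v) \<in> {x} \<times> {y}. u \<otimes>\<^bsub>H\<^esub> v = z}"
    by (rule mult_apply) (use assms z in \<open>auto simp: supp_on_def split: if_splits\<close>)
  also have "{(u, v) \<in> {x} \<times> {y}. u \<otimes>\<^bsub>H\<^esub> v = z} = (if x \<otimes>\<^bsub>H\<^esub> y = z then {(x, y)} else {})"
    by auto
  finally show "(e x \<otimes>\<^bsub>T\<^esub> e y) z = (\<sigma> (x, y) \<odot>\<^bsub>T\<^esub> e (x \<otimes>\<^bsub>H\<^esub> y)) z"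
    using assms z by auto
qed (use assms in auto)

lemma span_induct [consumes 1, case_names zero eta add]:
  assumes a: "a \<in> carrier T" and 0: "P \<zero>\<^bsub>T\<^esub>"
    and 1: "\<And>c x. \<lbrakk>c \<in> carrier F; x \<in> carrier H\<rbrakk> \<Longrightarrow> P (c \<odot>\<^bsub>T\<^esub> e x)"
    and 2: "\<And>b d. \<lbrakk>b \<in> carrier T; d \<in> carrier T; P b; P d\<rbrakk> \<Longrightarrow> P (b \<oplus>\<^bsub>T\<^esub> d)"
  shows "P a"
proof -
  have "\<lbrakk>finite S; a \<in> carrier T; supp_on F H a \<subseteq> S\<rbrakk> \<Longrightarrow> P a" for S a
  proof (induction S arbitrary: a rule: finite_induct)
    case empty
    then have "a = \<zero>\<^bsub>T\<^esub>" by (intro T_ext) (auto simp: supp_on_def)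
    then show ?case using 0 by simp
  next
    case (insert x S)
    show ?case
    proof (cases "x \<in> carrier H")
      case False
      then show ?thesis using insert by (intro insert.IH) (auto simp: supp_on_def)
    next
      case x: True
      define b where "b = (\<lambda>y\<in>carrier H. if y = x then \<zero>\<^bsub>F\<^esub> else a y)"
      have b: "b \<in> carrier T"
        by (rule T_I[of _ "supp_on F H a"])
          (use T_finite[OF insert.prems(1)] T_closed[OF insert.prems(1)] in \<open>auto simp: b_def supp_on_def\<close>)
      have "P b" by (rule insert.IH[OF b]) (use insert.prems(2) in \<open>auto simp: b_def supp_on_def split: if_splits\<close>)
      moreover have "a = a x \<odot>\<^bsub>T\<^esub> e x \<oplus>\<^bsub>T\<^esub> b"
        by (rule T_ext) (use insert.prems(1) b x T_closed[OF insert.prems(1)] in \<open>auto simp: b_def\<close>)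
      ultimately show ?thesis 
        using 2[OF smult_closed[OF T_closed[OF insert.prems(1) x] eta_closed] b
          1[OF T_closed[OF insert.prems(1) x] x]] by simp
    qed
  qed
  then show ?thesis using a T_finite by blast
qed

lemma mult_assoc:
  assumes a: "a \<in> carrier T" and b: "b \<in> carrier T" and d: "d \<in> carrier T"
  shows "(a \<otimes>\<^bsub>T\<^esub> b) \<otimes>\<^bsub>T\<^esub> d = a \<otimes>\<^bsub>T\<^esub> (b \<otimes>\<^bsub>T\<^esub> d)"
proof -
  interpret T: module F T by (rule T_module)
  have null: "\<zero>\<^bsub>T\<^esub> \<otimes>\<^bsub>T\<^esub> u = \<zero>\<^bsub>T\<^esub>" "u \<otimes>\<^bsub>T\<^esub> \<zero>\<^bsub>T\<^esub> = \<zero>\<^bsub>T\<^esub>" if "u \<in> carrier T" for u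
    using mult_smult[of "\<zero>\<^bsub>F\<^esub>" "\<zero>\<^bsub>T\<^esub>" u] mult_smult[of "\<zero>\<^bsub>F\<^esub>" u "\<zero>\<^bsub>T\<^esub>"] that by auto
  have etas: "(e x \<otimes>\<^bsub>T\<^esub> e y) \<otimes>\<^bsub>T\<^esub> e z = e x \<otimes>\<^bsub>T\<^esub> (e y \<otimes>\<^bsub>T\<^esub> e z)"
    if "x \<in> carrier H" "y \<in> carrier H" "z \<in> carrier H" for x y z
    using that sigma_cocycle[OF that]
    by (simp add: eta_mult mult_smult T.smult_assoc1[symmetric] H.m_assoc F.m_comm)
  show ?thesis using a
  proof (induction rule: span_induct)
    case zero then show ?case using b d null by simp
  next
    case (add u v) then show ?case using b d by (simp add: mult_add)
  next
    case x: (eta c x)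
    have "(e x \<otimes>\<^bsub>T\<^esub> b) \<otimes>\<^bsub>T\<^esub> d = e x \<otimes>\<^bsub>T\<^esub> (b \<otimes>\<^bsub>T\<^esub> d)" using b
    proof (induction rule: span_induct)
      case zero then show ?case using d null by simp
    next
      case (add u v) then show ?case using d by (simp add: mult_add)
    next
      case y: (eta c' y)
      have "(e x \<otimes>\<^bsub>T\<^esub> e y) \<otimes>\<^bsub>T\<^esub> d = e x \<otimes>\<^bsub>T\<^esub> (e y \<otimes>\<^bsub>T\<^esub> d)" using d
      proof (induction rule: span_induct)
        case zero then show ?case using null by simp
      next
        case (add u v) then show ?case by (simp add: mult_add)
      next
        case (eta c'' z) then show ?case using etas x y by (simp add: mult_smult)
      qed
      then show ?case using x y d by (simp add: mult_smult)
    qed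
    then show ?case using x b d by (simp add: mult_smult)
  qed
qed

theorem T_assoc_algebra: "assoc_algebra F T"
  by (intro assoc_algebra.intro assoc_algebra_axioms.intro F.field_axioms T_module)
    (auto simp: mult_assoc mult_add mult_smult)

lemma T_one:
  shows T_one_closed: "\<one>\<^bsub>T\<^esub> \<in> carrier T"
    and T_l_one: "a \<in> carrier T \<Longrightarrow> \<one>\<^bsub>T\<^esub> \<otimes>\<^bsub>T\<^esub> a = a"
    and T_r_one: "a \<in> carrier T \<Longrightarrow> a \<otimes>\<^bsub>T\<^esub> \<one>\<^bsub>T\<^esub> = a"
proof -
  interpret T: assoc_algebra F T by (rule T_assoc_algebra)
  let ?s = "\<sigma> (\<one>\<^bsub>H\<^esub>, \<one>\<^bsub>H\<^esub>)"
  define i where "i = inv\<^bsub>F\<^esub> ?s"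
  have "?s \<in> Units F" using sigma_closed[OF H.one_closed H.one_closed] F.field_Units by blast
  then have inv: "i \<in> carrier F" "i \<otimes>\<^bsub>F\<^esub> ?s = \<one>\<^bsub>F\<^esub>"
    unfolding i_def by (rule F.Units_inv_closed, rule F.Units_l_inv)
  have ext: "i \<odot>\<^bsub>T\<^esub> e \<one>\<^bsub>H\<^esub> \<in> extensional (carrier H)" by (rule tga_extensional)
  have one: "\<one>\<^bsub>T\<^esub> = i \<odot>\<^bsub>T\<^esub> e \<one>\<^bsub>H\<^esub>"
    unfolding tga_one i_def[symmetric]
    by (rule extensionalityI[OF restrict_extensional ext]) (use inv(1) in simp)
  have cl: "\<one>\<^bsub>T\<^esub> \<in> carrier T" unfolding one using inv(1) by simp
  then show "\<one>\<^bsub>T\<^esub> \<in> carrier T" .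
  have s: "\<sigma> (\<one>\<^bsub>H\<^esub>, x) = ?s" "\<sigma> (x, \<one>\<^bsub>H\<^esub>) = ?s" if x: "x \<in> carrier H" for x
  proof -
    have "?s \<otimes>\<^bsub>F\<^esub> \<sigma> (\<one>\<^bsub>H\<^esub>, x) = \<sigma> (\<one>\<^bsub>H\<^esub>, x) \<otimes>\<^bsub>F\<^esub> \<sigma> (\<one>\<^bsub>H\<^esub>, x)"
      using sigma_cocycle[of "\<one>\<^bsub>H\<^esub>" "\<one>\<^bsub>H\<^esub>" x] x by simp
    then show "\<sigma> (\<one>\<^bsub>H\<^esub>, x) = ?s"
      using F.m_rcancel[of "\<sigma> (\<one>\<^bsub>H\<^esub>, x)" ?s "\<sigma> (\<one>\<^bsub>H\<^esub>, x)"] x by simp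
    have "\<sigma> (x, \<one>\<^bsub>H\<^esub>) \<otimes>\<^bsub>F\<^esub> \<sigma> (x, \<one>\<^bsub>H\<^esub>) = \<sigma> (x, \<one>\<^bsub>H\<^esub>) \<otimes>\<^bsub>F\<^esub> ?s"
      using sigma_cocycle[of x "\<one>\<^bsub>H\<^esub>" "\<one>\<^bsub>H\<^esub>"] x by simp
    then show "\<sigma> (x, \<one>\<^bsub>H\<^esub>) = ?s"
      using F.m_lcancel[of "\<sigma> (x, \<one>\<^bsub>H\<^esub>)" "\<sigma> (x, \<one>\<^bsub>H\<^esub>)" ?s] x by simp
  qed
  have e: "\<one>\<^bsub>T\<^esub> \<otimes>\<^bsub>T\<^esub> e x = e x" "e x \<otimes>\<^bsub>T\<^esub> \<one>\<^bsub>T\<^esub> = e x" if x: "x \<in> carrier H" for x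
  proof -
    have "\<one>\<^bsub>T\<^esub> \<otimes>\<^bsub>T\<^esub> e x = (i \<otimes>\<^bsub>F\<^esub> ?s) \<odot>\<^bsub>T\<^esub> e x"
      unfolding one using inv(1) x by (simp add: mult_smult eta_mult s(1)[OF x] T.smult_assoc1)
    then show "\<one>\<^bsub>T\<^esub> \<otimes>\<^bsub>T\<^esub> e x = e x" by (simp add: inv)
    have "e x \<otimes>\<^bsub>T\<^esub> \<one>\<^bsub>T\<^esub> = (i \<otimes>\<^bsub>F\<^esub> ?s) \<odot>\<^bsub>T\<^esub> e x"
      unfolding one using inv(1) x by (simp add: mult_smult eta_mult s(2)[OF x] T.smult_assoc1)
    then show "e x \<otimes>\<^bsub>T\<^esub> \<one>\<^bsub>T\<^esub> = e x" by (simp add: inv)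
  qed
  have "\<one>\<^bsub>T\<^esub> \<otimes>\<^bsub>T\<^esub> a = a \<and> a \<otimes>\<^bsub>T\<^esub> \<one>\<^bsub>T\<^esub> = a" if "a \<in> carrier T" for a using that
  proof (induction rule: span_induct)
    case zero
    then show ?case
      using mult_smult[of "\<zero>\<^bsub>F\<^esub>" "\<zero>\<^bsub>T\<^esub>" "\<one>\<^bsub>T\<^esub>"] mult_smult[of "\<zero>\<^bsub>F\<^esub>" "\<one>\<^bsub>T\<^esub>" "\<zero>\<^bsub>T\<^esub>"] cl
      by simp
  next
    case (eta c x)
    then show ?case using cl by (simp add: mult_smult e)
  next
    case (add b d) then show ?case using cl by (simp add: mult_add)
  qed
  then show "a \<in> carrier T \<Longrightarrow> \<one>\<^bsub>T\<^esub> \<otimes>\<^bsub>T\<^esub> a = a" "a \<in> carrier T \<Longrightarrow> a \<otimes>\<^bsub>T\<^esub> \<one>\<^bsub>T\<^esub> = a"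
    by blast+
qed

lemma finsum_apply:
  assumes "finite S" "f \<in> S \<rightarrow> carrier T" "x \<in> carrier H"
  shows "(finsum T f S) x = (\<Oplus>\<^bsub>F\<^esub>s\<in>S. f s x)"
proof -
  interpret T: module F T by (rule T_module)
  show ?thesis using assms
    by (induction S rule: finite_induct) (simp_all add: Pi_def T_closed)
qed

end

theorem twisted_group_algebra_graded:
  fixes F (structure) and G (structure)
  assumes F: "field F" and G: "group G" and H: "subgroup H G"
    and \<sigma>: "\<sigma> \<in> carrier (cocycles2 (G\<lparr>carrier := H\<rparr>) (units_of F))"
  shows "graded_algebra F G (twisted_group_algebra F (G\<lparr>carrier := H\<rparr>) \<sigma>)
    (canonical_grading F (G\<lparr>carrier := H\<rparr>) \<sigma>)"
proof -
  interpret G: group G by (rule G)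
  interpret H: subgroup H G by (rule H)
  let ?H = "G\<lparr>carrier := H\<rparr>"
  interpret D: twisted_group_algebra_data F ?H \<sigma>
    by (intro twisted_group_algebra_data.intro twisted_group_algebra_data_axioms.intro F \<sigma>
        H.subgroup_is_group G)
  interpret T: assoc_algebra F D.T by (rule D.T_assoc_algebra)
  let ?C = "canonical_grading F ?H \<sigma>"
  have C_in: "?C x = {c \<odot>\<^bsub>D.T\<^esub> D.e x | c. c \<in> carrier F}" if "x \<in> H" for x
    using that by (simp add: canonical_grading_def)
  have C_out: "?C x = {\<zero>\<^bsub>D.T\<^esub>}" if "x \<notin> H" for x
    using that by (simp add: canonical_grading_def)
  have C_closed: "?C x \<subseteq> carrier D.T" for x
    by (cases "x \<in> H") (auto simp: C_in C_out)
  have C_eq: "v = v x \<odot>\<^bsub>D.T\<^esub> D.e x" if "v \<in> ?C x" "x \<in> H" for v x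
    using that by (auto simp: C_in)
  have C_vanish: "v y = \<zero>" if "v \<in> ?C x" "y \<in> H" "y \<noteq> x" for v x y
    using that by (cases "x \<in> H") (auto simp: C_in C_out)
  have C_zero: "\<zero>\<^bsub>D.T\<^esub> \<in> ?C x" for x
  proof (cases "x \<in> H")
    case True
    have "\<zero>\<^bsub>D.T\<^esub> = \<zero> \<odot>\<^bsub>D.T\<^esub> D.e x" by simp
    then show ?thesis unfolding C_in[OF True] by blast
  qed (simp add: C_out)
  have nonzero_H: "x \<in> H" if "v \<in> ?C x" "v \<noteq> \<zero>\<^bsub>D.T\<^esub>" for v x
    using that C_out by blast
  have eval: "(\<Oplus>\<^bsub>D.T\<^esub>x\<in>S. c x) y = c y y"
    if c: "\<And>x. x \<in> S \<Longrightarrow> c x \<in> ?C x" and S: "finite S" "\<And>x. c x \<noteq> \<zero>\<^bsub>D.T\<^esub> \<Longrightarrow> x \<in> carrier G \<Longrightarrow> x \<in> S"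
      and y: "y \<in> H" for c S y
  proof -
    have cl: "c \<in> S \<rightarrow> carrier D.T" using c C_closed by blast
    have y': "y \<in> carrier ?H" using y by simp
    have val: "c x y \<in> carrier F" if "x \<in> S" for x
      using D.T_closed[OF _ y'] cl that by blast
    have van: "c x y = \<zero>" if "x \<in> S" "x \<noteq> y" for x
      using C_vanish[OF c[OF that(1)] y] that(2) by blast
    have "(\<Oplus>\<^bsub>D.T\<^esub>x\<in>S. c x) y = (\<Oplus>x\<in>S. c x y)"
      by (rule D.finsum_apply[OF S(1) cl y'])
    also have "\<dots> = c y y"
    proof (cases "y \<in> S")
      case True
      have "(\<Oplus>x\<in>S. c x y) = (\<Oplus>x\<in>S. if y = x then c x y else \<zero>)"
      proof (rule D.F.finsum_cong'[OF refl])
        show "(\<lambda>x. if y = x then c x y else \<zero>) \<in> S \<rightarrow> carrier F"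
          by (rule Pi_I) (use val in auto)
        show "c x y = (if y = x then c x y else \<zero>)" if "x \<in> S" for x using van[OF that] by auto
      qed
      also have "\<dots> = c y y" using True S(1) val by (intro D.F.finsum_singleton) auto
      finally show ?thesis .
    next
      case False
      then have cy: "c y = \<zero>\<^bsub>D.T\<^esub>" using S(2)[of y] y H.subset by blast
      have "(\<Oplus>x\<in>S. c x y) = (\<Oplus>x\<in>S. \<zero>)"
      proof (rule D.F.finsum_cong'[OF refl])
        show "c x y = \<zero>" if "x \<in> S" for x using van[OF that] False that by blast
      qed simp
      also have "\<dots> = \<zero>" by (rule D.F.finsum_zero)
      also have "\<dots> = c y y" unfolding cy using D.zero_apply[OF y'] by simp
      finally show ?thesis .
    qed
    finally show ?thesis .
  qed
  show ?thesis
  proof (intro graded_algebra.intro graded_algebra_axioms.intro T.assoc_algebra_axioms G)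
    fix x assume "x \<in> carrier G"
    show "submodule (?C x) F D.T"
    proof (cases "x \<in> H")
      case True
      show ?thesis
      proof (rule T.submoduleI)
        fix a assume "a \<in> ?C x"
        then obtain c where c: "c \<in> carrier F" "a = c \<odot>\<^bsub>D.T\<^esub> D.e x" by (auto simp: C_in True)
        then have "\<ominus>\<^bsub>D.T\<^esub> a = (\<ominus> c) \<odot>\<^bsub>D.T\<^esub> D.e x" by (simp add: T.smult_l_minus)
        then show "\<ominus>\<^bsub>D.T\<^esub> a \<in> ?C x" using c by (auto simp: C_in True)
      next
        fix a b assume "a \<in> ?C x" "b \<in> ?C x"
        then obtain c d where c: "c \<in> carrier F" "a = c \<odot>\<^bsub>D.T\<^esub> D.e x"
            "d \<in> carrier F" "b = d \<odot>\<^bsub>D.T\<^esub> D.e x"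
          by (auto simp: C_in True)
        then have "a \<oplus>\<^bsub>D.T\<^esub> b = (c \<oplus> d) \<odot>\<^bsub>D.T\<^esub> D.e x" by (simp add: T.smult_l_distr)
        then show "a \<oplus>\<^bsub>D.T\<^esub> b \<in> ?C x" using c by (auto simp: C_in True)
      next
        fix c a assume c: "c \<in> carrier F" and "a \<in> ?C x"
        then obtain d where d: "d \<in> carrier F" "a = d \<odot>\<^bsub>D.T\<^esub> D.e x" by (auto simp: C_in True)
        then have "c \<odot>\<^bsub>D.T\<^esub> a = (c \<otimes> d) \<odot>\<^bsub>D.T\<^esub> D.e x" using c by (simp add: T.smult_assoc1)
        then show "c \<odot>\<^bsub>D.T\<^esub> a \<in> ?C x" using c d by (auto simp: C_in True)
      qed (use C_closed C_zero in auto)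
    next
      case False
      show ?thesis by (rule T.submoduleI) (auto simp: C_out False)
    qed
  next
    fix x y a b assume "x \<in> carrier G" "y \<in> carrier G" and ab: "a \<in> ?C x" "b \<in> ?C y"
    show "a \<otimes>\<^bsub>D.T\<^esub> b \<in> ?C (x \<otimes>\<^bsub>G\<^esub> y)"
    proof (cases "x \<in> H \<and> y \<in> H")
      case True
      then obtain c d where c: "c \<in> carrier F" "a = c \<odot>\<^bsub>D.T\<^esub> D.e x"
            "d \<in> carrier F" "b = d \<odot>\<^bsub>D.T\<^esub> D.e y"
        using ab by (auto simp: C_in)
      have "a \<otimes>\<^bsub>D.T\<^esub> b = (d \<otimes> (c \<otimes> \<sigma> (x, y))) \<odot>\<^bsub>D.T\<^esub> D.e (x \<otimes>\<^bsub>G\<^esub> y)"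
        using c True D.eta_mult[of x y] D.sigma_closed[of x y]
        by (simp add: D.mult_smult T.smult_assoc1)
      then show ?thesis using c True D.sigma_closed[of x y] by (auto simp: C_in)
    next
      case False
      then have "a = \<zero>\<^bsub>D.T\<^esub> \<or> b = \<zero>\<^bsub>D.T\<^esub>" using ab nonzero_H by blast
      moreover have "a \<in> carrier D.T" "b \<in> carrier D.T" using ab C_closed by auto
      ultimately have "a \<otimes>\<^bsub>D.T\<^esub> b = \<zero>\<^bsub>D.T\<^esub>"
        using D.mult_smult[of \<zero> "\<zero>\<^bsub>D.T\<^esub>" b] D.mult_smult[of \<zero> a "\<zero>\<^bsub>D.T\<^esub>"] by auto
      then show ?thesis using C_zero by simp
    qed
  next
    fix a assume a: "a \<in> carrier D.T"
    let ?P = "\<lambda>c. c \<in> (\<Pi>\<^sub>E x\<in>carrier G. ?C x) \<and> finite {x \<in> carrier G. c x \<noteq> \<zero>\<^bsub>D.T\<^esub>} \<and>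
      a = (\<Oplus>\<^bsub>D.T\<^esub>x\<in>{x \<in> carrier G. c x \<noteq> \<zero>\<^bsub>D.T\<^esub>}. c x)"
    define c where "c = (\<lambda>x\<in>carrier G. if x \<in> H then a x \<odot>\<^bsub>D.T\<^esub> D.e x else \<zero>\<^bsub>D.T\<^esub>)"
    have aH: "a x \<in> carrier F" if "x \<in> H" for x using D.T_closed[OF a] that by simp
    have c_C: "c x \<in> ?C x" if "x \<in> carrier G" for x
      using that aH by (cases "x \<in> H") (auto simp: c_def C_in C_out)
    show "\<exists>!c. ?P c"
    proof (rule ex1I)
      have sub: "{x \<in> carrier G. c x \<noteq> \<zero>\<^bsub>D.T\<^esub>} \<subseteq> supp_on F ?H a"
      proof
        fix x assume "x \<in> {x \<in> carrier G. c x \<noteq> \<zero>\<^bsub>D.T\<^esub>}"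
        then have "x \<in> H" "a x \<odot>\<^bsub>D.T\<^esub> D.e x \<noteq> \<zero>\<^bsub>D.T\<^esub>" by (auto simp: c_def split: if_splits)
        then show "x \<in> supp_on F ?H a" by (auto simp: supp_on_def)
      qed
      have fin: "finite {x \<in> carrier G. c x \<noteq> \<zero>\<^bsub>D.T\<^esub>}"
        using finite_subset[OF sub D.T_finite[OF a]] .
      have "a = (\<Oplus>\<^bsub>D.T\<^esub>x\<in>{x \<in> carrier G. c x \<noteq> \<zero>\<^bsub>D.T\<^esub>}. c x)"
      proof (rule D.T_ext[OF a])
        show "(\<Oplus>\<^bsub>D.T\<^esub>x\<in>{x \<in> carrier G. c x \<noteq> \<zero>\<^bsub>D.T\<^esub>}. c x) \<in> carrier D.T"
          using c_C C_closed by (intro T.M.finsum_closed) blast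
        fix y assume "y \<in> carrier ?H"
        then have y: "y \<in> H" by simp
        show "a y = (\<Oplus>\<^bsub>D.T\<^esub>x\<in>{x \<in> carrier G. c x \<noteq> \<zero>\<^bsub>D.T\<^esub>}. c x) y"
          by (subst eval) (use fin c_C y aH in \<open>auto simp: c_def\<close>)
      qed
      then show "?P c" using fin c_C by (auto simp: c_def)
    next
      fix d assume d: "?P d"
      have "d x = c x" if x: "x \<in> carrier G" for x
      proof (cases "x \<in> H")
        case True
        have "a x = (\<Oplus>\<^bsub>D.T\<^esub>x\<in>{x \<in> carrier G. d x \<noteq> \<zero>\<^bsub>D.T\<^esub>}. d x) x" using d by metis
        also have "\<dots> = d x x" by (rule eval) (use d True in \<open>auto simp: PiE_def Pi_def\<close>)
        finally have "a x = d x x" .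
        moreover have "d x \<in> ?C x" using d x by auto
        ultimately show ?thesis using C_eq[of "d x" x] True x by (simp add: c_def)
      next
        case False
        have "d x \<in> ?C x" using d x by auto
        then show ?thesis using False x by (simp add: C_out c_def)
      qed
      moreover have "c \<in> (\<Pi>\<^sub>E x\<in>carrier G. ?C x)"
        using c_C by (simp add: PiE_def Pi_def c_def)
      ultimately show "d = c" using d PiE_ext by blast
    qed
  qed
qed

theorem cocycles2_comm_group:
  assumes "group H" and M: "comm_group M"
  shows "comm_group (cocycles2 H M)"
proof -
  interpret H: group H by fact
  interpret M: comm_group M by fact
  let ?Z = "cocycles2 H M"
  have cl: "s (x, y) \<in> carrier M" if "s \<in> carrier ?Z" "x \<in> carrier H" "y \<in> carrier H" for s x y
    using that by (auto simp: cocycles2_def PiE_def Pi_def)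
  have co: "s (x, y) \<otimes>\<^bsub>M\<^esub> s (x \<otimes>\<^bsub>H\<^esub> y, z) = s (x, y \<otimes>\<^bsub>H\<^esub> z) \<otimes>\<^bsub>M\<^esub> s (y, z)"
    if "s \<in> carrier ?Z" "x \<in> carrier H" "y \<in> carrier H" "z \<in> carrier H" for s x y z
    using that by (auto simp: cocycles2_def)
  have ext: "s = t" if "s \<in> carrier ?Z" "t \<in> carrier ?Z"
    "\<And>x y. \<lbrakk>x \<in> carrier H; y \<in> carrier H\<rbrakk> \<Longrightarrow> s (x, y) = t (x, y)" for s t
    by (rule extensionalityI[of _ "carrier H \<times> carrier H"])
      (use that in \<open>auto simp: cocycles2_def PiE_def\<close>)
  have mul: "(s \<otimes>\<^bsub>?Z\<^esub> t) (x, y) = s (x, y) \<otimes>\<^bsub>M\<^esub> t (x, y)"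
    if "x \<in> carrier H" "y \<in> carrier H" for s t x y
    using that by (simp add: cocycles2_def)
  have one: "\<one>\<^bsub>?Z\<^esub> (x, y) = \<one>\<^bsub>M\<^esub>" if "x \<in> carrier H" "y \<in> carrier H" for x y
    using that by (simp add: cocycles2_def)
  have I: "s \<in> carrier ?Z"
    if "s \<in> extensional (carrier H \<times> carrier H)"
      "\<And>x y. \<lbrakk>x \<in> carrier H; y \<in> carrier H\<rbrakk> \<Longrightarrow> s (x, y) \<in> carrier M"
      "\<And>x y z. \<lbrakk>x \<in> carrier H; y \<in> carrier H; z \<in> carrier H\<rbrakk> \<Longrightarrow>
        s (x, y) \<otimes>\<^bsub>M\<^esub> s (x \<otimes>\<^bsub>H\<^esub> y, z) = s (x, y \<otimes>\<^bsub>H\<^esub> z) \<otimes>\<^bsub>M\<^esub> s (y, z)" for s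
    using that by (auto simp: cocycles2_def PiE_def)
  have one_cl: "\<one>\<^bsub>?Z\<^esub> \<in> carrier ?Z"
    by (rule I) (auto simp: one, simp add: cocycles2_def)
  have mult_cl: "s \<otimes>\<^bsub>?Z\<^esub> t \<in> carrier ?Z" if s: "s \<in> carrier ?Z" and t: "t \<in> carrier ?Z" for s t
  proof (rule I)
    show "s \<otimes>\<^bsub>?Z\<^esub> t \<in> extensional (carrier H \<times> carrier H)" by (simp add: cocycles2_def)
    fix x y z assume h: "x \<in> carrier H" "y \<in> carrier H" "z \<in> carrier H"
    have swap: "(a \<otimes>\<^bsub>M\<^esub> b) \<otimes>\<^bsub>M\<^esub> (c \<otimes>\<^bsub>M\<^esub> d) = (a \<otimes>\<^bsub>M\<^esub> c) \<otimes>\<^bsub>M\<^esub> (b \<otimes>\<^bsub>M\<^esub> d)"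
      if "a \<in> carrier M" "b \<in> carrier M" "c \<in> carrier M" "d \<in> carrier M" for a b c d
      using that by (simp add: M.m_ac)
    have "(s \<otimes>\<^bsub>?Z\<^esub> t) (x, y) \<otimes>\<^bsub>M\<^esub> (s \<otimes>\<^bsub>?Z\<^esub> t) (x \<otimes>\<^bsub>H\<^esub> y, z) =
        (s (x, y) \<otimes>\<^bsub>M\<^esub> s (x \<otimes>\<^bsub>H\<^esub> y, z)) \<otimes>\<^bsub>M\<^esub> (t (x, y) \<otimes>\<^bsub>M\<^esub> t (x \<otimes>\<^bsub>H\<^esub> y, z))"
      using h s t by (simp only: mul cl swap H.m_closed)
    also have "\<dots> = (s (x, y \<otimes>\<^bsub>H\<^esub> z) \<otimes>\<^bsub>M\<^esub> s (y, z)) \<otimes>\<^bsub>M\<^esub> (t (x, y \<otimes>\<^bsub>H\<^esub> z) \<otimes>\<^bsub>M\<^esub> t (y, z))"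
      using h s t by (simp only: co)
    also have "\<dots> = (s \<otimes>\<^bsub>?Z\<^esub> t) (x, y \<otimes>\<^bsub>H\<^esub> z) \<otimes>\<^bsub>M\<^esub> (s \<otimes>\<^bsub>?Z\<^esub> t) (y, z)"
      using h s t by (simp only: mul cl swap H.m_closed)
    finally show "(s \<otimes>\<^bsub>?Z\<^esub> t) (x, y) \<otimes>\<^bsub>M\<^esub> (s \<otimes>\<^bsub>?Z\<^esub> t) (x \<otimes>\<^bsub>H\<^esub> y, z) =
        (s \<otimes>\<^bsub>?Z\<^esub> t) (x, y \<otimes>\<^bsub>H\<^esub> z) \<otimes>\<^bsub>M\<^esub> (s \<otimes>\<^bsub>?Z\<^esub> t) (y, z)" .
  qed (use s t in \<open>auto simp: mul cl\<close>)
  show ?thesis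
  proof (rule comm_groupI)
    fix s assume s: "s \<in> carrier ?Z"
    define t where "t = (\<lambda>p\<in>carrier H \<times> carrier H. inv\<^bsub>M\<^esub> s p)"
    have "t \<in> carrier ?Z"
    proof (rule I)
      fix x y z assume h: "x \<in> carrier H" "y \<in> carrier H" "z \<in> carrier H"
      then show "t (x, y) \<otimes>\<^bsub>M\<^esub> t (x \<otimes>\<^bsub>H\<^esub> y, z) = t (x, y \<otimes>\<^bsub>H\<^esub> z) \<otimes>\<^bsub>M\<^esub> t (y, z)"
        using s by (simp add: t_def M.inv_mult[symmetric] cl co)
    qed (use s in \<open>auto simp: t_def cl\<close>)
    moreover from this have "t \<otimes>\<^bsub>?Z\<^esub> s = \<one>\<^bsub>?Z\<^esub>"
      by (intro ext mult_cl s one_cl) (auto simp: mul one t_def cl s)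
    ultimately show "\<exists>t\<in>carrier ?Z. t \<otimes>\<^bsub>?Z\<^esub> s = \<one>\<^bsub>?Z\<^esub>" by blast
  qed (auto intro!: ext mult_cl one_cl simp: mul one cl M.m_ac)
qed

theorem coboundaries2_subgroup:
  assumes "group H" and M: "comm_group M"
  shows "subgroup (coboundaries2 H M) (cocycles2 H M)"
proof -
  interpret H: group H by fact
  interpret M: comm_group M by fact
  interpret Z: comm_group "cocycles2 H M" by (rule cocycles2_comm_group) fact+
  let ?Z = "cocycles2 H M"
  define d where "d = (\<lambda>f. \<lambda>(x, y)\<in>carrier H \<times> carrier H.
    f x \<otimes>\<^bsub>M\<^esub> f y \<otimes>\<^bsub>M\<^esub> inv\<^bsub>M\<^esub> f (x \<otimes>\<^bsub>H\<^esub> y))"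
  have B: "coboundaries2 H M = d ` (carrier H \<rightarrow> carrier M)"
    by (auto simp: coboundaries2_def d_def)
  have d_apply: "d f (x, y) = f x \<otimes>\<^bsub>M\<^esub> f y \<otimes>\<^bsub>M\<^esub> inv\<^bsub>M\<^esub> f (x \<otimes>\<^bsub>H\<^esub> y)"
    if "x \<in> carrier H" "y \<in> carrier H" for f x y using that by (simp add: d_def)
  have d_cl: "d f \<in> carrier ?Z" if f: "f \<in> carrier H \<rightarrow> carrier M" for f
  proof -
    have fc: "f x \<in> carrier M" if "x \<in> carrier H" for x using f that by blast
    have cancel: "(a \<otimes>\<^bsub>M\<^esub> b \<otimes>\<^bsub>M\<^esub> inv\<^bsub>M\<^esub> u) \<otimes>\<^bsub>M\<^esub> (u \<otimes>\<^bsub>M\<^esub> c \<otimes>\<^bsub>M\<^esub> w) =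
        (a \<otimes>\<^bsub>M\<^esub> v \<otimes>\<^bsub>M\<^esub> w) \<otimes>\<^bsub>M\<^esub> (b \<otimes>\<^bsub>M\<^esub> c \<otimes>\<^bsub>M\<^esub> inv\<^bsub>M\<^esub> v)"
      if h: "a \<in> carrier M" "b \<in> carrier M" "c \<in> carrier M" "u \<in> carrier M" "v \<in> carrier M"
        "w \<in> carrier M" for a b c u v w
    proof -
      have "(a \<otimes>\<^bsub>M\<^esub> b \<otimes>\<^bsub>M\<^esub> inv\<^bsub>M\<^esub> u) \<otimes>\<^bsub>M\<^esub> (u \<otimes>\<^bsub>M\<^esub> c \<otimes>\<^bsub>M\<^esub> w) =
          (u \<otimes>\<^bsub>M\<^esub> inv\<^bsub>M\<^esub> u) \<otimes>\<^bsub>M\<^esub> (a \<otimes>\<^bsub>M\<^esub> (b \<otimes>\<^bsub>M\<^esub> (c \<otimes>\<^bsub>M\<^esub> w)))"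
        using h by (simp only: M.m_ac M.m_closed M.inv_closed)
      also have "\<dots> = (v \<otimes>\<^bsub>M\<^esub> inv\<^bsub>M\<^esub> v) \<otimes>\<^bsub>M\<^esub> (a \<otimes>\<^bsub>M\<^esub> (b \<otimes>\<^bsub>M\<^esub> (c \<otimes>\<^bsub>M\<^esub> w)))"
        using h by simp
      also have "\<dots> = (a \<otimes>\<^bsub>M\<^esub> v \<otimes>\<^bsub>M\<^esub> w) \<otimes>\<^bsub>M\<^esub> (b \<otimes>\<^bsub>M\<^esub> c \<otimes>\<^bsub>M\<^esub> inv\<^bsub>M\<^esub> v)"
        using h by (simp only: M.m_ac M.m_closed M.inv_closed)
      finally show ?thesis .
    qed
    have "d f (x, y) \<otimes>\<^bsub>M\<^esub> d f (x \<otimes>\<^bsub>H\<^esub> y, z) = d f (x, y \<otimes>\<^bsub>H\<^esub> z) \<otimes>\<^bsub>M\<^esub> d f (y, z)"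
      if "x \<in> carrier H" "y \<in> carrier H" "z \<in> carrier H" for x y z
      using that by (simp add: d_apply H.m_assoc cancel fc)
    moreover have "d f \<in> carrier H \<times> carrier H \<rightarrow>\<^sub>E carrier M"
      using fc by (auto simp: d_def)
    ultimately show ?thesis by (auto simp: cocycles2_def)
  qed
  have ext: "s = t" if "s \<in> carrier ?Z" "t \<in> carrier ?Z"
    "\<And>x y. \<lbrakk>x \<in> carrier H; y \<in> carrier H\<rbrakk> \<Longrightarrow> s (x, y) = t (x, y)" for s t
    by (rule extensionalityI[of _ "carrier H \<times> carrier H"])
      (use that in \<open>auto simp: cocycles2_def PiE_def\<close>)
  have d_mult: "d f \<otimes>\<^bsub>?Z\<^esub> d g = d (\<lambda>x. f x \<otimes>\<^bsub>M\<^esub> g x)"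
    if f: "f \<in> carrier H \<rightarrow> carrier M" and g: "g \<in> carrier H \<rightarrow> carrier M" for f g
  proof (rule ext)
    fix x y assume h: "x \<in> carrier H" "y \<in> carrier H"
    have cl: "f z \<in> carrier M" "g z \<in> carrier M" if "z \<in> carrier H" for z using f g that by auto
    have "(d f \<otimes>\<^bsub>?Z\<^esub> d g) (x, y) = d f (x, y) \<otimes>\<^bsub>M\<^esub> d g (x, y)"
      using h by (simp add: cocycles2_def)
    also have "\<dots> = d (\<lambda>x. f x \<otimes>\<^bsub>M\<^esub> g x) (x, y)"
      using h cl by (simp add: d_apply M.inv_mult M.m_ac)
    finally show "(d f \<otimes>\<^bsub>?Z\<^esub> d g) (x, y) = d (\<lambda>x. f x \<otimes>\<^bsub>M\<^esub> g x) (x, y)" .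
  qed (use f g in \<open>auto intro!: d_cl Z.m_closed\<close>)
  have d_one: "d (\<lambda>_. \<one>\<^bsub>M\<^esub>) = \<one>\<^bsub>?Z\<^esub>"
    by (intro ext d_cl Z.one_closed) (auto simp: d_apply cocycles2_def)
  show ?thesis
  proof (rule Z.subgroupI)
    show "coboundaries2 H M \<subseteq> carrier ?Z" using d_cl by (auto simp: B)
    show "coboundaries2 H M \<noteq> {}" by (auto simp: B intro!: exI[of _ "\<lambda>_. \<one>\<^bsub>M\<^esub>"])
  next
    fix s assume "s \<in> coboundaries2 H M"
    then obtain f where f: "f \<in> carrier H \<rightarrow> carrier M" "s = d f" by (auto simp: B)
    let ?g = "\<lambda>x. inv\<^bsub>M\<^esub> f x"
    have g: "?g \<in> carrier H \<rightarrow> carrier M" using f by auto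
    have "d ?g \<otimes>\<^bsub>?Z\<^esub> s = d (\<lambda>x. ?g x \<otimes>\<^bsub>M\<^esub> f x)" unfolding f(2) by (rule d_mult[OF g f(1)])
    also have "\<dots> = d (\<lambda>_. \<one>\<^bsub>M\<^esub>)"
      unfolding d_def by (rule restrict_ext) (use f in \<open>auto simp: Pi_def\<close>)
    finally have "d ?g \<otimes>\<^bsub>?Z\<^esub> s = \<one>\<^bsub>?Z\<^esub>" by (simp add: d_one)
    then have "inv\<^bsub>?Z\<^esub> s = d ?g" using f d_cl g by (intro Z.inv_equality) auto
    then show "inv\<^bsub>?Z\<^esub> s \<in> coboundaries2 H M" using g by (auto simp: B)
  next
    fix s t assume "s \<in> coboundaries2 H M" "t \<in> coboundaries2 H M"
    then show "s \<otimes>\<^bsub>?Z\<^esub> t \<in> coboundaries2 H M"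
      by (auto simp: B d_mult Pi_def intro!: imageI)
  qed
qed

corollary cohomology2_group:
  assumes "group H" and "comm_group M"
  shows "group (cohomology2 H M)"
proof -
  interpret Z: comm_group "cocycles2 H M" by (rule cocycles2_comm_group) fact+
  show ?thesis unfolding cohomology2_def
    by (intro normal.factorgroup_is_group Z.subgroup_imp_normal coboundaries2_subgroup assms)
qed

lemma cohomology_class_in_carrier:
  "\<sigma> \<in> carrier (cocycles2 H M) \<Longrightarrow> cohomology_class H M \<sigma> \<in> carrier (cohomology2 H M)"
  by (auto simp: cohomology2_def cohomology_class_def FactGroup_def RCOSETS_def)

end

theory Submission
  imports Defs
begin

text \<open>A graded imbedding sends each \<open>\<eta>\<^sub>\<xi>\<close> to a nonzero homogeneous element of the same degree,
  that is, to \<open>f(\<xi>) \<eta>\<^sub>\<xi>\<close> with \<open>f(\<xi>) \<in> \<bbbF>\<^sup>*\<close>; in particular \<open>\<xi> \<in> H\<^sub>2\<close>. Such a linear map is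
  multiplicative if and only if \<open>\<sigma>\<^sub>1(\<xi>,\<zeta>) f(\<xi>\<zeta>) = \<sigma>\<^sub>2(\<xi>,\<zeta>) f(\<xi>) f(\<zeta>)\<close>, which says that \<open>\<sigma>\<^sub>1\<close>
  and the restriction of \<open>\<sigma>\<^sub>2\<close> differ by the coboundary of \<open>f\<close>.\<close>

section \<open>Equality of cohomology classes\<close>

lemma cohomology_class_eq_iff:
  assumes H: "group H" and M: "comm_group M"
    and s: "\<sigma> \<in> carrier (cocycles2 H M)" and t: "\<tau> \<in> carrier (cocycles2 H M)"
  shows "cohomology_class H M \<sigma> = cohomology_class H M \<tau> \<longleftrightarrow>
    (\<exists>f \<in> carrier H \<rightarrow> carrier M. \<forall>x\<in>carrier H. \<forall>y\<in>carrier H.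
      \<sigma> (x, y) \<otimes>\<^bsub>M\<^esub> f (x \<otimes>\<^bsub>H\<^esub> y) = \<tau> (x, y) \<otimes>\<^bsub>M\<^esub> (f x \<otimes>\<^bsub>M\<^esub> f y))"
proof -
  interpret H: group H by fact
  interpret M: comm_group M by fact
  interpret Z: comm_group "cocycles2 H M" by (rule cocycles2_comm_group) fact+
  let ?Z = "cocycles2 H M"
  have B: "subgroup (coboundaries2 H M) ?Z" by (rule coboundaries2_subgroup) fact+
  define d where "d = (\<lambda>f. \<lambda>(x, y)\<in>carrier H \<times> carrier H.
    f x \<otimes>\<^bsub>M\<^esub> f y \<otimes>\<^bsub>M\<^esub> inv\<^bsub>M\<^esub> f (x \<otimes>\<^bsub>H\<^esub> y))"
  have B_eq: "coboundaries2 H M = d ` (carrier H \<rightarrow> carrier M)"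
    by (auto simp: coboundaries2_def d_def)
  have cl: "\<sigma> (x, y) \<in> carrier M" "\<tau> (x, y) \<in> carrier M" if "x \<in> carrier H" "y \<in> carrier H" for x y
    using s t that by (auto simp: cocycles2_def PiE_def Pi_def)
  have ext: "\<sigma> \<in> extensional (carrier H \<times> carrier H)"
    using s by (auto simp: cocycles2_def PiE_def)
  have "\<sigma> = d f \<otimes>\<^bsub>?Z\<^esub> \<tau> \<longleftrightarrow> (\<forall>x\<in>carrier H. \<forall>y\<in>carrier H.
      \<sigma> (x, y) \<otimes>\<^bsub>M\<^esub> f (x \<otimes>\<^bsub>H\<^esub> y) = \<tau> (x, y) \<otimes>\<^bsub>M\<^esub> (f x \<otimes>\<^bsub>M\<^esub> f y))"
    if f: "f \<in> carrier H \<rightarrow> carrier M" for f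
  proof -
    have fc: "f x \<in> carrier M" if "x \<in> carrier H" for x using f that by blast
    have mul: "d f \<otimes>\<^bsub>?Z\<^esub> \<tau> = (\<lambda>p\<in>carrier H \<times> carrier H. d f p \<otimes>\<^bsub>M\<^esub> \<tau> p)"
      by (simp add: cocycles2_def)
    have "\<sigma> = d f \<otimes>\<^bsub>?Z\<^esub> \<tau> \<longleftrightarrow>
        (\<forall>x\<in>carrier H. \<forall>y\<in>carrier H. \<sigma> (x, y) = d f (x, y) \<otimes>\<^bsub>M\<^esub> \<tau> (x, y))"
      unfolding mul by (auto intro: extensionalityI[OF ext restrict_extensional] dest: fun_cong)
    also have "\<dots> \<longleftrightarrow> (\<forall>x\<in>carrier H. \<forall>y\<in>carrier H.
        \<sigma> (x, y) \<otimes>\<^bsub>M\<^esub> f (x \<otimes>\<^bsub>H\<^esub> y) = \<tau> (x, y) \<otimes>\<^bsub>M\<^esub> (f x \<otimes>\<^bsub>M\<^esub> f y))"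
    proof (intro ball_cong refl)
      fix x y assume h: "x \<in> carrier H" "y \<in> carrier H"
      have "d f (x, y) \<otimes>\<^bsub>M\<^esub> \<tau> (x, y) = \<tau> (x, y) \<otimes>\<^bsub>M\<^esub> (f x \<otimes>\<^bsub>M\<^esub> f y) \<otimes>\<^bsub>M\<^esub> inv\<^bsub>M\<^esub> f (x \<otimes>\<^bsub>H\<^esub> y)"
        using h fc cl by (simp add: d_def M.m_ac)
      then show "\<sigma> (x, y) = d f (x, y) \<otimes>\<^bsub>M\<^esub> \<tau> (x, y) \<longleftrightarrow>
          \<sigma> (x, y) \<otimes>\<^bsub>M\<^esub> f (x \<otimes>\<^bsub>H\<^esub> y) = \<tau> (x, y) \<otimes>\<^bsub>M\<^esub> (f x \<otimes>\<^bsub>M\<^esub> f y)"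
        using h fc cl by (metis H.m_closed M.m_closed M.inv_solve_right)
    qed
    finally show ?thesis .
  qed
  \<comment> \<open>An element lies in its own coset, which gives one direction; a coset is
    determined by any of its elements, which gives the other.\<close>
  moreover have "cohomology_class H M \<sigma> = cohomology_class H M \<tau> \<longleftrightarrow>
      \<sigma> \<in> coboundaries2 H M #>\<^bsub>?Z\<^esub> \<tau>"
    unfolding cohomology_class_def
    using Z.repr_independence[OF _ t B] Z.rcos_self[OF s B] by auto
  moreover have "\<dots> \<longleftrightarrow> (\<exists>f \<in> carrier H \<rightarrow> carrier M. \<sigma> = d f \<otimes>\<^bsub>?Z\<^esub> \<tau>)"
    by (auto simp: r_coset_def B_eq)
  ultimately show ?thesis by auto
qed

lemma cocycle_restrict_closed:
  assumes H: "group H" and K: "subgroup K H" and s: "\<sigma> \<in> carrier (cocycles2 H M)"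
  shows "cocycle_restrict \<sigma> K \<in> carrier (cocycles2 (H\<lparr>carrier := K\<rparr>) M)"
proof -
  interpret K: subgroup K H by fact
  show ?thesis
    using s by (auto simp: cocycles2_def cocycle_restrict_def PiE_def Pi_def)
qed

section \<open>From an imbedding to a scalar function on the smaller group\<close>

text \<open>The groups share only their multiplication, as two subgroups of one group do. The
  inclusion of carriers is left out because it is a conclusion in one direction and a hypothesis in
  the other.\<close>

locale twisted_group_algebra_pair =
  T1: twisted_group_algebra_data F H\<^sub>1 \<sigma>\<^sub>1 + T2: twisted_group_algebra_data F H\<^sub>2 \<sigma>\<^sub>2
  for F (structure) and H\<^sub>1 :: "('g, 'n) monoid_scheme" and \<sigma>\<^sub>1
    and H\<^sub>2 :: "('g, 'n) monoid_scheme" and \<sigma>\<^sub>2 +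
  assumes mult_eq: "x \<otimes>\<^bsub>H\<^sub>1\<^esub> y = x \<otimes>\<^bsub>H\<^sub>2\<^esub> y"
begin

text \<open>The image of a product of two basis elements is computed twice, by multiplying before
  and after applying \<open>\<psi>\<close>; the two resulting multiples of one basis element are
  then compared.\<close>

lemma rescaling_of_homogeneous_hom:
  assumes closed: "\<psi> \<in> carrier T1.T \<rightarrow> carrier T2.T"
    and smult: "\<And>c a. \<lbrakk>c \<in> carrier F; a \<in> carrier T1.T\<rbrakk> \<Longrightarrow> \<psi> (c \<odot>\<^bsub>T1.T\<^esub> a) = c \<odot>\<^bsub>T2.T\<^esub> \<psi> a"
    and mult: "\<And>a b. \<lbrakk>a \<in> carrier T1.T; b \<in> carrier T1.T\<rbrakk> \<Longrightarrow> \<psi> (a \<otimes>\<^bsub>T1.T\<^esub> b) = \<psi> a \<otimes>\<^bsub>T2.T\<^esub> \<psi> b"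
    and graded: "\<And>x. x \<in> carrier H\<^sub>1 \<Longrightarrow>
      \<psi> ` canonical_grading F H\<^sub>1 \<sigma>\<^sub>1 x \<subseteq> canonical_grading F H\<^sub>2 \<sigma>\<^sub>2 x"
    and inj: "inj_on \<psi> (carrier T1.T)"
  shows "carrier H\<^sub>1 \<subseteq> carrier H\<^sub>2"
    and "\<exists>f \<in> carrier H\<^sub>1 \<rightarrow> carrier F - {\<zero>}. \<forall>x\<in>carrier H\<^sub>1. \<forall>y\<in>carrier H\<^sub>1.
      \<sigma>\<^sub>1 (x, y) \<otimes> f (x \<otimes>\<^bsub>H\<^sub>1\<^esub> y) = \<sigma>\<^sub>2 (x, y) \<otimes> (f x \<otimes> f y)"
proof -
  interpret M1: module F T1.T by (rule T1.T_module)
  interpret M2: module F T2.T by (rule T2.T_module)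
  \<comment> \<open>The image of \<open>T1.e x\<close> will turn out to be a multiple of
    \<open>T2.e x\<close>, and its value at \<open>x\<close> is the factor. Reading it off there
    makes sense because \<open>key\<close> also places \<open>x\<close> in
    \<open>H\<^sub>2\<close>.\<close>
  define f where "f = (\<lambda>x. \<psi> (T1.e x) x)"
  \<comment> \<open>This comes from homogeneity for the scalar zero. Zero must be known to be
    distinct from the image of each basis element, by injectivity.\<close>
  have \<psi>_zero: "\<psi> \<zero>\<^bsub>T1.T\<^esub> = \<zero>\<^bsub>T2.T\<^esub>"
  proof -
    have "\<psi> \<zero>\<^bsub>T1.T\<^esub> \<in> carrier T2.T" using closed T1.zero_closed by blast
    then show ?thesis using smult[of \<zero> "\<zero>\<^bsub>T1.T\<^esub>"] by simp
  qed
  have key: "x \<in> carrier H\<^sub>2 \<and> \<psi> (T1.e x) = f x \<odot>\<^bsub>T2.T\<^esub> T2.e x \<and> f x \<in> carrier F - {\<zero>}"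
    if x: "x \<in> carrier H\<^sub>1" for x
  proof -
    have "\<exists>c. T1.e x = c \<odot>\<^bsub>T1.T\<^esub> T1.e x \<and> c \<in> carrier F"
      by (intro exI[of _ \<one>]) simp
    then have "T1.e x \<in> canonical_grading F H\<^sub>1 \<sigma>\<^sub>1 x"
      using x by (simp add: canonical_grading_def)
    then have in_gr: "\<psi> (T1.e x) \<in> canonical_grading F H\<^sub>2 \<sigma>\<^sub>2 x" using graded[OF x] by blast
    have "T1.e x \<noteq> \<zero>\<^bsub>T1.T\<^esub>" using x T1.eta_apply[of x x] by (metis T1.zero_apply T1.F.one_not_zero)
    then have nz: "\<psi> (T1.e x) \<noteq> \<zero>\<^bsub>T2.T\<^esub>"
      using inj_onD[OF inj, of "T1.e x" "\<zero>\<^bsub>T1.T\<^esub>"] \<psi>_zero by auto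
    \<comment> \<open>For \<open>x\<close> outside \<open>H\<^sub>2\<close> the component of degree
      \<open>x\<close> is zero, so a nonzero image rules this case out.\<close>
    then have x2: "x \<in> carrier H\<^sub>2" using in_gr by (auto simp: canonical_grading_def split: if_splits)
    then obtain c where c: "c \<in> carrier F" "\<psi> (T1.e x) = c \<odot>\<^bsub>T2.T\<^esub> T2.e x"
      using in_gr by (auto simp: canonical_grading_def)
    moreover have "f x = c" using c x2 by (simp add: f_def)
    moreover have "c \<noteq> \<zero>" using nz c by auto
    ultimately show ?thesis using x2 by simp
  qed
  then show "carrier H\<^sub>1 \<subseteq> carrier H\<^sub>2" by blast
  have "\<sigma>\<^sub>1 (x, y) \<otimes> f (x \<otimes>\<^bsub>H\<^sub>1\<^esub> y) = \<sigma>\<^sub>2 (x, y) \<otimes> (f x \<otimes> f y)"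
    if x: "x \<in> carrier H\<^sub>1" and y: "y \<in> carrier H\<^sub>1" for x y
  proof -
    let ?z = "x \<otimes>\<^bsub>H\<^sub>1\<^esub> y"
    have z: "?z \<in> carrier H\<^sub>1" using x y by simp
    note [simp] = T1.sigma_closed(1)[OF x y] T2.sigma_closed(1)[of x y]
    have "\<sigma>\<^sub>1 (x, y) \<odot>\<^bsub>T2.T\<^esub> (f ?z \<odot>\<^bsub>T2.T\<^esub> T2.e ?z) = \<psi> (T1.e x \<otimes>\<^bsub>T1.T\<^esub> T1.e y)"
      using key[OF z] x y by (simp add: T1.eta_mult smult)
    also have "\<dots> = (f x \<odot>\<^bsub>T2.T\<^esub> T2.e x) \<otimes>\<^bsub>T2.T\<^esub> (f y \<odot>\<^bsub>T2.T\<^esub> T2.e y)"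
      using key[OF x] key[OF y] by (simp add: mult)
    also have "\<dots> = f y \<odot>\<^bsub>T2.T\<^esub> (f x \<odot>\<^bsub>T2.T\<^esub> (\<sigma>\<^sub>2 (x, y) \<odot>\<^bsub>T2.T\<^esub> T2.e ?z))"
      using key[OF x] key[OF y] by (simp add: T2.mult_smult T2.eta_mult mult_eq)
    \<comment> \<open>Evaluation at \<open>?z\<close>, where \<open>T2.e ?z\<close> has the value
      one, turns the equation in the algebra into one between scalars.\<close>
    finally have "(\<sigma>\<^sub>1 (x, y) \<odot>\<^bsub>T2.T\<^esub> (f ?z \<odot>\<^bsub>T2.T\<^esub> T2.e ?z)) ?z =
        (f y \<odot>\<^bsub>T2.T\<^esub> (f x \<odot>\<^bsub>T2.T\<^esub> (\<sigma>\<^sub>2 (x, y) \<odot>\<^bsub>T2.T\<^esub> T2.e ?z))) ?z" by simp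
    then show ?thesis using key[OF x] key[OF y] key[OF z] by (simp add: T1.F.m_ac)
  qed
  then show "\<exists>f \<in> carrier H\<^sub>1 \<rightarrow> carrier F - {\<zero>}. \<forall>x\<in>carrier H\<^sub>1. \<forall>y\<in>carrier H\<^sub>1.
      \<sigma>\<^sub>1 (x, y) \<otimes> f (x \<otimes>\<^bsub>H\<^sub>1\<^esub> y) = \<sigma>\<^sub>2 (x, y) \<otimes> (f x \<otimes> f y)"
    using key by (intro bexI[of _ f]) auto
qed

section \<open>From a scalar function to an imbedding\<close>

text \<open>On coefficient functions this is the linear map that multiplies each basis element by
  its scalar. Elements of the first algebra take the value \<open>undefined\<close> off
  \<open>H\<^sub>1\<close>, so the coefficients there have to be set to zero explicitly.\<close>

definition rescale :: "('g \<Rightarrow> 'a) \<Rightarrow> ('g \<Rightarrow> 'a) \<Rightarrow> 'g \<Rightarrow> 'a" where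
  "rescale f a = (\<lambda>x\<in>carrier H\<^sub>2. if x \<in> carrier H\<^sub>1 then f x \<otimes> a x else \<zero>)"

lemma rescale_apply [simp]:
  "x \<in> carrier H\<^sub>2 \<Longrightarrow> rescale f a x = (if x \<in> carrier H\<^sub>1 then f x \<otimes> a x else \<zero>)"
  by (simp add: rescale_def)

context
  fixes f
  assumes sub: "carrier H\<^sub>1 \<subseteq> carrier H\<^sub>2"
    and f: "f \<in> carrier H\<^sub>1 \<rightarrow> carrier F - {\<zero>}"
begin

lemma rescale_closed:
  assumes a: "a \<in> carrier T1.T"
  shows "rescale f a \<in> carrier T2.T"
  by (rule T2.T_I[of _ "supp_on F H\<^sub>1 a"])
    (use f T1.T_finite[OF a] T1.T_closed[OF a] in \<open>auto simp: rescale_def supp_on_def Pi_def\<close>)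

text \<open>This allows a product of rescaled elements to be summed over the supports of the
  original ones, so that both sides of multiplicativity have the same index set.\<close>

lemma supp_rescale: "a \<in> carrier T1.T \<Longrightarrow> supp_on F H\<^sub>2 (rescale f a) \<subseteq> supp_on F H\<^sub>1 a"
  using f by (force simp: supp_on_def Pi_def split: if_splits)

lemma rescale_add:
  assumes a: "a \<in> carrier T1.T" and b: "b \<in> carrier T1.T"
  shows "rescale f (a \<oplus>\<^bsub>T1.T\<^esub> b) = rescale f a \<oplus>\<^bsub>T2.T\<^esub> rescale f b"
  by (rule T2.T_ext)
    (use a b f in \<open>auto simp: rescale_closed Pi_def T1.T_closed T1.F.r_distr\<close>)

lemma rescale_smult:
  assumes c: "c \<in> carrier F" and a: "a \<in> carrier T1.T"
  shows "rescale f (c \<odot>\<^bsub>T1.T\<^esub> a) = c \<odot>\<^bsub>T2.T\<^esub> rescale f a"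
  by (rule T2.T_ext)
    (use a c f in \<open>auto simp: rescale_closed Pi_def T1.T_closed T1.F.m_ac\<close>)

text \<open>Both coefficients at \<open>z\<close> are sums over the pairs in the supports with
  product \<open>z\<close>. For \<open>z\<close> in \<open>H\<^sub>1\<close> they agree term by
  term, by \<open>tw\<close> multiplied with \<open>a x \<otimes> b y\<close>.\<close>

lemma rescale_mult:
  assumes tw: "\<And>x y. \<lbrakk>x \<in> carrier H\<^sub>1; y \<in> carrier H\<^sub>1\<rbrakk> \<Longrightarrow>
      \<sigma>\<^sub>1 (x, y) \<otimes> f (x \<otimes>\<^bsub>H\<^sub>1\<^esub> y) = \<sigma>\<^sub>2 (x, y) \<otimes> (f x \<otimes> f y)"
    and a: "a \<in> carrier T1.T" and b: "b \<in> carrier T1.T"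
  shows "rescale f (a \<otimes>\<^bsub>T1.T\<^esub> b) = rescale f a \<otimes>\<^bsub>T2.T\<^esub> rescale f b"
proof (rule T2.T_ext)
  show "rescale f (a \<otimes>\<^bsub>T1.T\<^esub> b) \<in> carrier T2.T" "rescale f a \<otimes>\<^bsub>T2.T\<^esub> rescale f b \<in> carrier T2.T"
    using a b by (simp_all add: rescale_closed)
  fix z assume z: "z \<in> carrier H\<^sub>2"
  let ?S = "supp_on F H\<^sub>1 a" and ?R = "supp_on F H\<^sub>1 b"
  let ?D = "{(x, y) \<in> ?S \<times> ?R. x \<otimes>\<^bsub>H\<^sub>1\<^esub> y = z}"
  have fc: "f x \<in> carrier F" if "x \<in> carrier H\<^sub>1" for x using f that by blast
  have S: "x \<in> carrier H\<^sub>1" "x \<in> carrier H\<^sub>2" "a x \<in> carrier F" if "x \<in> ?S" for x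
    using that sub T1.T_closed[OF a] by (auto simp: supp_on_def)
  have R: "x \<in> carrier H\<^sub>1" "x \<in> carrier H\<^sub>2" "b x \<in> carrier F" if "x \<in> ?R" for x
    using that sub T1.T_closed[OF b] by (auto simp: supp_on_def)
  have fin: "finite ?D" by (rule finite_subset[of _ "?S \<times> ?R"]) (use a b in auto)
  have rhs: "(rescale f a \<otimes>\<^bsub>T2.T\<^esub> rescale f b) z =
      finsum F (\<lambda>(x, y). rescale f a x \<otimes> rescale f b y \<otimes> \<sigma>\<^sub>2 (x, y)) ?D"
    unfolding mult_eq
    by (rule T2.mult_apply) (use a b z S R supp_rescale in \<open>auto simp: rescale_closed\<close>)
  show "rescale f (a \<otimes>\<^bsub>T1.T\<^esub> b) z = (rescale f a \<otimes>\<^bsub>T2.T\<^esub> rescale f b) z"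
  proof (cases "z \<in> carrier H\<^sub>1")
    case True
    have "rescale f (a \<otimes>\<^bsub>T1.T\<^esub> b) z = f z \<otimes> finsum F (\<lambda>(x, y). a x \<otimes> b y \<otimes> \<sigma>\<^sub>1 (x, y)) ?D"
      using True z by (simp add: tga_mult)
    also have "\<dots> = (\<Oplus>p\<in>?D. f z \<otimes> (case p of (x, y) \<Rightarrow> a x \<otimes> b y \<otimes> \<sigma>\<^sub>1 (x, y)))"
      by (rule T1.F.finsum_rdistr) (use fin fc True S R in auto)
    also have "\<dots> = finsum F (\<lambda>(x, y). rescale f a x \<otimes> rescale f b y \<otimes> \<sigma>\<^sub>2 (x, y)) ?D"
    proof (rule T1.F.finsum_cong'[OF refl])
      show "(\<lambda>(x, y). rescale f a x \<otimes> rescale f b y \<otimes> \<sigma>\<^sub>2 (x, y)) \<in> ?D \<rightarrow> carrier F"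
        using S R fc by auto
      fix p assume "p \<in> ?D"
      then obtain x y where p: "p = (x, y)" "x \<in> ?S" "y \<in> ?R" "x \<otimes>\<^bsub>H\<^sub>1\<^esub> y = z" by auto
      note cl = S[OF p(2)] R[OF p(3)]
      note [simp] = cl fc T1.sigma_closed(1)[of x y] T2.sigma_closed(1)[of x y]
      have "f z \<otimes> (a x \<otimes> b y \<otimes> \<sigma>\<^sub>1 (x, y)) = a x \<otimes> b y \<otimes> (\<sigma>\<^sub>1 (x, y) \<otimes> f z)"
        using True by (simp add: T1.F.m_ac)
      also have "\<dots> = a x \<otimes> b y \<otimes> (\<sigma>\<^sub>2 (x, y) \<otimes> (f x \<otimes> f y))"
        using tw[of x y] p(4) by simp
      also have "\<dots> = rescale f a x \<otimes> rescale f b y \<otimes> \<sigma>\<^sub>2 (x, y)"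
        by (simp add: T1.F.m_ac)
      finally show "f z \<otimes> (case p of (x, y) \<Rightarrow> a x \<otimes> b y \<otimes> \<sigma>\<^sub>1 (x, y)) =
          (case p of (x, y) \<Rightarrow> rescale f a x \<otimes> rescale f b y \<otimes> \<sigma>\<^sub>2 (x, y))"
        using p(1) by simp
    qed
    finally show ?thesis using rhs by simp
  next
    case False
    \<comment> \<open>Both supports lie in the group \<open>H\<^sub>1\<close>, so no pair has a
      product outside it.\<close>
    then have D: "?D = {}" using S(1) R(1) T1.H.m_closed by blast
    have "(rescale f a \<otimes>\<^bsub>T2.T\<^esub> rescale f b) z = \<zero>"
      unfolding rhs D by simp
    then show ?thesis using False z by simp
  qed
qed

text \<open>This covers every degree: outside \<open>H\<^sub>1\<close> the source component is zero,
  and zero lies in each target component, whether or not the degree belongs to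
  \<open>H\<^sub>2\<close>.\<close>

lemma rescale_graded:
  "rescale f ` canonical_grading F H\<^sub>1 \<sigma>\<^sub>1 x \<subseteq> canonical_grading F H\<^sub>2 \<sigma>\<^sub>2 x"
proof -
  have zero: "rescale f \<zero>\<^bsub>T1.T\<^esub> = \<zero>\<^bsub>T2.T\<^esub>"
    by (rule T2.T_ext) (use f in \<open>auto simp: rescale_closed Pi_def\<close>)
  have eta: "rescale f (c \<odot>\<^bsub>T1.T\<^esub> T1.e x) = (f x \<otimes> c) \<odot>\<^bsub>T2.T\<^esub> T2.e x"
    if "x \<in> carrier H\<^sub>1" "c \<in> carrier F" for c
    by (rule T2.T_ext)
      (use f that in \<open>auto simp: rescale_closed Pi_def\<close>)
  have z2: "\<zero>\<^bsub>T2.T\<^esub> \<in> canonical_grading F H\<^sub>2 \<sigma>\<^sub>2 x"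
  proof -
    interpret M2: module F T2.T by (rule T2.T_module)
    have "\<exists>c. \<zero>\<^bsub>T2.T\<^esub> = c \<odot>\<^bsub>T2.T\<^esub> T2.e x \<and> c \<in> carrier F"
      by (intro exI[of _ \<zero>]) simp
    then show ?thesis by (simp add: canonical_grading_def)
  qed
  show ?thesis
  proof (cases "x \<in> carrier H\<^sub>1")
    case True
    then have "f x \<in> carrier F" using f by blast
    then show ?thesis using True sub by (auto simp: canonical_grading_def eta subset_iff)
  next
    case False
    then show ?thesis using zero z2 by (simp add: canonical_grading_def[of F H\<^sub>1])
  qed
qed

text \<open>By the inclusion, every coefficient survives in the image up to a nonzero factor, which
  cancels.\<close>

lemma rescale_inj: "inj_on (rescale f) (carrier T1.T)"
proof (rule inj_onI)
  fix a b assume a: "a \<in> carrier T1.T" and b: "b \<in> carrier T1.T" and eq: "rescale f a = rescale f b"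
  show "a = b"
  proof (rule T1.T_ext[OF a b])
    fix x assume x: "x \<in> carrier H\<^sub>1"
    then have "f x \<otimes> a x = f x \<otimes> b x"
      using fun_cong[OF eq, of x] sub by auto
    then show "a x = b x"
      using x f T1.T_closed[OF a x] T1.T_closed[OF b x] T1.F.m_lcancel[of "f x" "a x" "b x"] by auto
  qed
qed

end

end

section \<open>The equivalence for subgroups of a common group\<close>

theorem lemma4p2:
  fixes F :: "('f, 'm) ring_scheme" and G :: "('g, 'n) monoid_scheme"
    and H\<^sub>1 H\<^sub>2 :: "'g set" and \<sigma>\<^sub>1 \<sigma>\<^sub>2 :: "'g \<times> 'g \<Rightarrow> 'f"
  assumes "field F" and "group G"
    and "subgroup H\<^sub>1 G" and "subgroup H\<^sub>2 G"
    and "\<sigma>\<^sub>1 \<in> carrier (cocycles2 (G\<lparr>carrier := H\<^sub>1\<rparr>) (units_of F))"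
    and "\<sigma>\<^sub>2 \<in> carrier (cocycles2 (G\<lparr>carrier := H\<^sub>2\<rparr>) (units_of F))"
  shows "(\<exists>\<psi>. graded_imbedding F G
            (twisted_group_algebra F (G\<lparr>carrier := H\<^sub>1\<rparr>) \<sigma>\<^sub>1)
            (canonical_grading F (G\<lparr>carrier := H\<^sub>1\<rparr>) \<sigma>\<^sub>1)
            (twisted_group_algebra F (G\<lparr>carrier := H\<^sub>2\<rparr>) \<sigma>\<^sub>2)
            (canonical_grading F (G\<lparr>carrier := H\<^sub>2\<rparr>) \<sigma>\<^sub>2) \<psi>)
         \<longleftrightarrow> cocycle_pair_le F G (H\<^sub>1, \<sigma>\<^sub>1) (H\<^sub>2, \<sigma>\<^sub>2)"
proof -
  interpret F: field F by fact
  interpret G: group G by fact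
  let ?H1 = "G\<lparr>carrier := H\<^sub>1\<rparr>" and ?H2 = "G\<lparr>carrier := H\<^sub>2\<rparr>"
  let ?T1 = "twisted_group_algebra F ?H1 \<sigma>\<^sub>1" and ?T2 = "twisted_group_algebra F ?H2 \<sigma>\<^sub>2"
  let ?C1 = "canonical_grading F ?H1 \<sigma>\<^sub>1" and ?C2 = "canonical_grading F ?H2 \<sigma>\<^sub>2"
  have g1: "group ?H1" and g2: "group ?H2"
    using assms by (simp_all add: G.subgroup_imp_group)
  interpret P: twisted_group_algebra_pair F ?H1 \<sigma>\<^sub>1 ?H2 \<sigma>\<^sub>2
    by (intro twisted_group_algebra_pair.intro twisted_group_algebra_pair_axioms.intro
        twisted_group_algebra_data.intro twisted_group_algebra_data_axioms.intro g1 g2 assms) simp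
  have gr1: "graded_algebra F G ?T1 ?C1" and gr2: "graded_algebra F G ?T2 ?C2"
    by (rule twisted_group_algebra_graded; fact)+
  have U: "carrier (units_of F) = carrier F - {\<zero>\<^bsub>F\<^esub>}" by (simp add: units_of_def F.field_Units)
  \<comment> \<open>The inclusion makes the restriction of \<open>\<sigma>\<^sub>2\<close> a cocycle
    on \<open>H\<^sub>1\<close>. It has the values of \<open>\<sigma>\<^sub>2\<close> there, and the
    units of a field are its nonzero elements, so the criterion becomes the scalar equation of the
    rescaling lemmas.\<close>
  have class_iff: "cohomology_class ?H1 (units_of F) \<sigma>\<^sub>1 =
      cohomology_class ?H1 (units_of F) (cocycle_restrict \<sigma>\<^sub>2 H\<^sub>1) \<longleftrightarrow>
    (\<exists>f \<in> H\<^sub>1 \<rightarrow> carrier F - {\<zero>\<^bsub>F\<^esub>}. \<forall>x\<in>H\<^sub>1. \<forall>y\<in>H\<^sub>1.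
      \<sigma>\<^sub>1 (x, y) \<otimes>\<^bsub>F\<^esub> f (x \<otimes>\<^bsub>G\<^esub> y) = \<sigma>\<^sub>2 (x, y) \<otimes>\<^bsub>F\<^esub> (f x \<otimes>\<^bsub>F\<^esub> f y))"
    if "subgroup H\<^sub>1 ?H2"
  proof -
    have "cocycle_restrict \<sigma>\<^sub>2 H\<^sub>1 \<in> carrier (cocycles2 ?H1 (units_of F))"
      using cocycle_restrict_closed[OF g2 that assms(6)] by simp
    note cohomology_class_eq_iff[OF g1 F.units_comm_group assms(5) this]
    then show ?thesis by (simp add: U units_of_mult cocycle_restrict_def)
  qed
  show ?thesis
  proof
    assume "\<exists>\<psi>. graded_imbedding F G ?T1 ?C1 ?T2 ?C2 \<psi>"
    then obtain \<psi> where "graded_imbedding F G ?T1 ?C1 ?T2 ?C2 \<psi>" ..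
    then interpret I: graded_imbedding F G ?T1 ?C1 ?T2 ?C2 \<psi> .
    have "\<psi> ` ?C1 x \<subseteq> ?C2 x" if "x \<in> carrier ?H1" for x
      using that I.hom_graded[of x] subgroup.subset[OF assms(3)] by auto
    note h = P.rescaling_of_homogeneous_hom[OF I.hom_closed I.hom_smult I.hom_mult this I.inj]
    have "subgroup H\<^sub>1 ?H2" using h(1) assms(3,4) by (intro G.subgroup_incl) auto
    then show "cocycle_pair_le F G (H\<^sub>1, \<sigma>\<^sub>1) (H\<^sub>2, \<sigma>\<^sub>2)"
      using class_iff h(2) by (simp add: cocycle_pair_le_def)
  next
    assume le: "cocycle_pair_le F G (H\<^sub>1, \<sigma>\<^sub>1) (H\<^sub>2, \<sigma>\<^sub>2)"
    then have sg: "subgroup H\<^sub>1 ?H2" by (simp add: cocycle_pair_le_def)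
    then have sub: "carrier ?H1 \<subseteq> carrier ?H2" using subgroup.subset[OF sg] by simp
    \<comment> \<open>The coboundary of this \<open>f\<close> is the quotient of
      \<open>\<sigma>\<^sub>1\<close> by the restriction of \<open>\<sigma>\<^sub>2\<close>;
      rescaling by it is the required imbedding.\<close>
    obtain f where f: "f \<in> carrier ?H1 \<rightarrow> carrier F - {\<zero>\<^bsub>F\<^esub>}"
      and tw: "\<And>x y. \<lbrakk>x \<in> carrier ?H1; y \<in> carrier ?H1\<rbrakk> \<Longrightarrow>
        \<sigma>\<^sub>1 (x, y) \<otimes>\<^bsub>F\<^esub> f (x \<otimes>\<^bsub>?H1\<^esub> y) = \<sigma>\<^sub>2 (x, y) \<otimes>\<^bsub>F\<^esub> (f x \<otimes>\<^bsub>F\<^esub> f y)"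
      using le class_iff[OF sg] by (auto simp: cocycle_pair_le_def)
    have "graded_imbedding F G ?T1 ?C1 ?T2 ?C2 (P.rescale f)"
      by (intro graded_imbedding.intro graded_imbedding_axioms.intro graded_hom.intro
          graded_hom_axioms.intro gr1 gr2 funcsetI P.rescale_closed[OF sub f] P.rescale_add[OF sub f]
          P.rescale_smult[OF sub f] P.rescale_mult[OF sub f tw] P.rescale_graded[OF sub f]
          P.rescale_inj[OF sub f])
    then show "\<exists>\<psi>. graded_imbedding F G ?T1 ?C1 ?T2 ?C2 \<psi>" by blast
  qed
qed

end
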